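(* Let $\Phi\in C^\infty(\mathbb R_{>0},\mathbb R_{>0})$, let $\ell(c)=\int_{S^1}|c_\theta|d\theta$ denote the length, and let $\Omega^{\Phi(\ell)}=-d(\Phi(\ell)\,\Theta^{\mathrm{id}})$ on $\mathrm{Imm}(S^1,\mathbb R^3)$. Let $H:\mathrm{Imm}(S^1,\mathbb R^3)\to\mathbb R$ be a $\mathrm{Diff}^+(S^1)$-invariant Hamiltonian for which $\mathrm{grad}^{G^{\mathrm{id}}}H$ exists. (a) If $\Phi(\ell)\neq C\ell^{-3}$ (that is, $\Phi$ is not of the form $C\ell^{-3}$ with a constant $C$), then $$\mathrm{hgrad}_c^{\Omega^{\Phi(\ell)}}H=\frac1{3\Phi(\ell(c))}\Big\{-D_sc\times\mathrm{grad}_c^{G^{\mathrm{id}}}H+\frac{\Phi'(\ell(c))}{3\Phi(\ell(c))+\Phi'(\ell(c))\ell(c)}\Big[\big\langle D_s^2c,\,D_sc\times\mathrm{grad}_c^{G^{\mathrm{id}}}H\big\rangle_{L^2_{ds}}\,D_sc\times(D_sc\times c)+\big\langle c,\mathrm{grad}_c^{G^{\mathrm{id}}}H\big\rangle_{L^2_{ds}}\,D_sc\times D_s^2c\Big]\Big\}.$$ (b) If $\Phi(\ell)=C\ell^{-3}$ for a constant $C$, and if $H$ is invariant under $\mathrm{Diff}^+(S^1)$ and under the flows of $I$ and of $\mathrm{hgrad}^{\Omega^{\mathrm{MW}}}\ell=D_sc\times D_s^2c$, then $\mathrm{hgrad}_c^{\Omega^{\Phi(\ell)}}H$ is the orthogonal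 projection of $$X_c^H=-\frac{\ell(c)^3}{3C}\,D_sc\times\mathrm{grad}_c^{G^{\mathrm{id}}}H$$ to the $G^{\mathrm{id}}_c$-orthogonal complement of the kernel of $\Omega^{\Phi(\ell)}$, which is spanned by $I$, $\mathrm{hgrad}^{\Omega^{\mathrm{MW}}}\ell$ and $\{a\,D_sc:a\in C^\infty(S^1)\}$.
   Context: $\mathrm{Imm}(S^1,\mathbb R^3)=\{c\in C^\infty(S^1,\mathbb R^3): |c_\theta|\neq 0 \text{ everywhere}\}$ is an open subset of $C^\infty(S^1,\mathbb R^3)$, with tangent spaces $C^\infty(S^1,\mathbb R^3)$. For an immersion $c$, $D_s=\frac1{|c_\theta|}\partial_\theta$, $ds=|c_\theta|\,d\theta$; $\times$ is the cross product on $\mathbb R^3$. $I$ is the scaling vector field $I_c=c$. $\mathrm{Diff}^+(S^1)$ acts by reparametrization. $\langle h,k\rangle_{L^2_{ds}}=G^{\mathrm{id}}_c(h,k)=\int_{S^1}\langle h,k\rangle ds$; $\mathrm{grad}^{G^{\mathrm{id}}}E$ is the vector field with $G^{\mathrm{id}}(\mathrm{grad}^{G^{\mathrm{id}}}E,\cdot)=dE$. $\Theta^{\mathrm{id}}_c(h)=\int_{S^1}\langle c\times D_sc,h\rangle ds$, $\Omega^{\mathrm{id}}_c(h,k)=-d\Theta^{\mathrm{id}}_c(h,k)=3\int_{S^1}\langle D_sc\times h,k\rangle ds$, and $\Omega^{\mathrm{MW}}=\frac13\Omega^{\mathrm{id}}$ is the Marsden–Weinstein form. One has $\Omega^{\Phi(\ell)}=\Phi(\ell)\Omega^{\mathrm{id}}+\Theta^{\mathrm{id}}\wedge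 d(\Phi(\ell))$, with $(\alpha\wedge\beta)(h,k)=\alpha(h)\beta(k)-\alpha(k)\beta(h)$. For $\Omega^{\mathrm{MW}}$, and for $\Omega^{\Phi(\ell)}$ in case (a), the horizontal Hamiltonian vector field $\mathrm{hgrad}^{\Omega}H$ is the vector field $X$ with $i_X\Omega=dH$ and $\langle X_c,D_sc\rangle=0$ pointwise. In case (b), where the kernel of $\Omega^{\Phi(\ell)}$ is larger than $\{a\,D_sc\}$, $\mathrm{hgrad}^{\Omega^{\Phi(\ell)}}H$ is the vector field $X$ with $i_X\Omega^{\Phi(\ell)}=dH$ chosen $G^{\mathrm{id}}$-orthogonal to the whole kernel.
   Formalization: In (a) the last term must read −⟨c, grad H⟩ D_sc×D_s²c; the printed + fails for H=ℓ whenever Φ'(ℓ)≠0. The formula is asserted at those c where 3Φ(ℓ(c))+Φ'(ℓ(c))ℓ(c)≠0, since otherwise its denominator vanishes. *)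

theory Defs
  imports "HOL-Analysis.Analysis"
begin

(* Intended for open S, where this is the usual notion of C^n. *)
primrec higher_diff_on ::
    "'a::real_normed_vector set \<Rightarrow> nat \<Rightarrow> ('a \<Rightarrow> 'b::real_normed_vector) \<Rightarrow> bool" where
  "higher_diff_on S 0 f \<longleftrightarrow> continuous_on S f"
| "higher_diff_on S (Suc n) f \<longleftrightarrow>
     (\<forall>x\<in>S. f differentiable (at x)) \<and>
     (\<forall>v. higher_diff_on S n (\<lambda>x. frechet_derivative f (at x) v))"

definition smooth_on :: "'a::real_normed_vector set \<Rightarrow> ('a \<Rightarrow> 'b::real_normed_vector) \<Rightarrow> bool" where
  "smooth_on S f \<longleftrightarrow> (\<forall>n. higher_diff_on S n f)"

(* S^1 = R / 2 pi Z, so functions on the circle are 2 pi-periodic functions on R. *)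
definition Csm :: "(real \<Rightarrow> 'a::real_normed_vector) set" where
  "Csm = {f. smooth_on UNIV f \<and> (\<forall>\<theta>. f (\<theta> + 2 * pi) = f \<theta>)}"

type_synonym scurve = "real \<Rightarrow> real^3"

definition dth :: "scurve \<Rightarrow> scurve" where
  "dth f = (\<lambda>\<theta>. vector_derivative f (at \<theta>))"

definition Imm :: "scurve set" where
  "Imm = {c \<in> Csm. \<forall>\<theta>. dth c \<theta> \<noteq> 0}"

(* Lifts to R of the orientation preserving diffeomorphisms of the circle. *)
definition DiffP :: "(real \<Rightarrow> real) set" where
  "DiffP = {\<phi>. smooth_on UNIV \<phi> \<and> (\<forall>\<theta>. deriv \<phi> \<theta> > 0) \<and> (\<forall>\<theta>. \<phi> (\<theta> + 2 * pi) = \<phi> \<theta> + 2 * pi)}"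

definition DiffP_invariant :: "(scurve \<Rightarrow> real) \<Rightarrow> bool" where
  "DiffP_invariant H \<longleftrightarrow> (\<forall>c\<in>Imm. \<forall>\<phi>\<in>DiffP. H (c \<circ> \<phi>) = H c)"

definition Ds :: "scurve \<Rightarrow> scurve \<Rightarrow> scurve" where
  "Ds c f = (\<lambda>\<theta>. dth f \<theta> /\<^sub>R norm (dth c \<theta>))"

definition int_ds :: "scurve \<Rightarrow> (real \<Rightarrow> real) \<Rightarrow> real" where
  "int_ds c f = integral {0..2 * pi} (\<lambda>\<theta>. f \<theta> * norm (dth c \<theta>))"

definition len :: "scurve \<Rightarrow> real" where
  "len c = integral {0..2 * pi} (\<lambda>\<theta>. norm (dth c \<theta>))"

definition G_id :: "scurve \<Rightarrow> scurve \<Rightarrow> scurve \<Rightarrow> real" where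
  "G_id c h k = int_ds c (\<lambda>\<theta>. h \<theta> \<bullet> k \<theta>)"

definition fcross :: "scurve \<Rightarrow> scurve \<Rightarrow> scurve" (infixr "\<times>\<^sub>3" 80) where
  "f \<times>\<^sub>3 g = (\<lambda>\<theta>. cross3 (f \<theta>) (g \<theta>))"

definition differential :: "(scurve \<Rightarrow> real) \<Rightarrow> scurve \<Rightarrow> scurve \<Rightarrow> real" where
  "differential F c h = deriv (\<lambda>t. F (\<lambda>\<theta>. c \<theta> + t *\<^sub>R h \<theta>)) 0"

(* Exterior derivative of a one-form on an open subset of a vector space: the arguments h, k
   are extended to constant vector fields, whose Lie bracket vanishes. *)
definition ext_d :: "(scurve \<Rightarrow> scurve \<Rightarrow> real) \<Rightarrow> scurve \<Rightarrow> scurve \<Rightarrow> scurve \<Rightarrow> real" where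
  "ext_d \<alpha> c h k = differential (\<lambda>c'. \<alpha> c' k) c h - differential (\<lambda>c'. \<alpha> c' h) c k"

definition Theta_id :: "scurve \<Rightarrow> scurve \<Rightarrow> real" where
  "Theta_id c h = int_ds c (\<lambda>\<theta>. (c \<times>\<^sub>3 Ds c c) \<theta> \<bullet> h \<theta>)"

definition Omega_id :: "scurve \<Rightarrow> scurve \<Rightarrow> scurve \<Rightarrow> real" where
  "Omega_id c h k = - ext_d Theta_id c h k"

definition Omega_MW :: "scurve \<Rightarrow> scurve \<Rightarrow> scurve \<Rightarrow> real" where
  "Omega_MW c h k = Omega_id c h k / 3"

definition Omega_Phi :: "(real \<Rightarrow> real) \<Rightarrow> scurve \<Rightarrow> scurve \<Rightarrow> scurve \<Rightarrow> real" where
  "Omega_Phi \<Phi> c h k = - ext_d (\<lambda>c' h'. \<Phi> (len c') * Theta_id c' h') c h k"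

(* A smooth curve in C^\<infinity>(S^1, R^3) is a map that is jointly smooth in (t, \<theta>). *)
definition smooth_path :: "real set \<Rightarrow> (real \<Rightarrow> scurve) \<Rightarrow> bool" where
  "smooth_path J \<gamma> \<longleftrightarrow>
     (\<forall>t\<in>J. \<gamma> t \<in> Imm) \<and> smooth_on (J \<times> UNIV) (\<lambda>(t, \<theta>). \<gamma> t \<theta>)"

definition velocity :: "(real \<Rightarrow> scurve) \<Rightarrow> real \<Rightarrow> scurve" where
  "velocity \<gamma> t = (\<lambda>\<theta>. vector_derivative (\<lambda>s. \<gamma> s \<theta>) (at t))"

(* Differentiability along smooth paths (as in convenient calculus): the derivative along a path
   depends only on its velocity. This is implied by smoothness of F on Imm. *)
definition differentiable_Imm :: "(scurve \<Rightarrow> real) \<Rightarrow> scurve \<Rightarrow> bool" where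
  "differentiable_Imm F c \<longleftrightarrow>
     (\<forall>J \<gamma>. open J \<and> 0 \<in> J \<and> smooth_path J \<gamma> \<and> \<gamma> 0 = c \<longrightarrow>
        ((\<lambda>t. F (\<gamma> t)) has_real_derivative differential F c (velocity \<gamma> 0)) (at 0))"

definition is_grad_id :: "(scurve \<Rightarrow> real) \<Rightarrow> (scurve \<Rightarrow> scurve) \<Rightarrow> bool" where
  "is_grad_id F g \<longleftrightarrow>
     (\<forall>c\<in>Imm. differentiable_Imm F c \<and> g c \<in> Csm \<and>
        (\<forall>h\<in>Csm. G_id c (g c) h = differential F c h))"

(* A local flow of the vector field X: J c is the time interval of the flow line through c. *)
definition is_flow ::
    "(scurve \<Rightarrow> scurve) \<Rightarrow> (scurve \<Rightarrow> real set) \<Rightarrow> (real \<Rightarrow> scurve \<Rightarrow> scurve) \<Rightarrow> bool" where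
  "is_flow X J Fl \<longleftrightarrow>
     (\<forall>c\<in>Imm. open (J c) \<and> is_interval (J c) \<and> 0 \<in> J c \<and>
        Fl 0 c = c \<and> smooth_path (J c) (\<lambda>t. Fl t c) \<and>
        (\<forall>t\<in>J c. velocity (\<lambda>s. Fl s c) t = X (Fl t c)))"

definition flow_invariant :: "(scurve \<Rightarrow> scurve) \<Rightarrow> (scurve \<Rightarrow> real) \<Rightarrow> bool" where
  "flow_invariant X H \<longleftrightarrow>
     (\<exists>J Fl. is_flow X J Fl \<and> (\<forall>c\<in>Imm. \<forall>t\<in>J c. H (Fl t c) = H c))"

definition scaling_field :: "scurve \<Rightarrow> scurve" where
  "scaling_field c = c"

definition binormal_field :: "scurve \<Rightarrow> scurve" where
  "binormal_field c = Ds c c \<times>\<^sub>3 Ds c (Ds c c)"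

definition ker_form :: "(scurve \<Rightarrow> scurve \<Rightarrow> scurve \<Rightarrow> real) \<Rightarrow> scurve \<Rightarrow> scurve set" where
  "ker_form \<Omega> c = {h \<in> Csm. \<forall>k\<in>Csm. \<Omega> c h k = 0}"

definition orth_compl :: "scurve \<Rightarrow> scurve set \<Rightarrow> scurve set" where
  "orth_compl c K = {h \<in> Csm. \<forall>k\<in>K. G_id c h k = 0}"

definition is_orth_proj :: "scurve \<Rightarrow> scurve set \<Rightarrow> scurve \<Rightarrow> scurve \<Rightarrow> bool" where
  "is_orth_proj c W v p \<longleftrightarrow> p \<in> W \<and> (\<forall>w\<in>W. G_id c (\<lambda>\<theta>. v \<theta> - p \<theta>) w = 0)"

definition is_ham ::
    "(scurve \<Rightarrow> scurve \<Rightarrow> scurve \<Rightarrow> real) \<Rightarrow> (scurve \<Rightarrow> real) \<Rightarrow> scurve \<Rightarrow> scurve \<Rightarrow> bool" where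
  "is_ham \<Omega> H c X \<longleftrightarrow> X \<in> Csm \<and> (\<forall>k\<in>Csm. \<Omega> c X k = differential H c k)"

(* The horizontal Hamiltonian vector field at c, when the kernel of the form is {a D_s c}. *)
definition is_hgrad ::
    "(scurve \<Rightarrow> scurve \<Rightarrow> scurve \<Rightarrow> real) \<Rightarrow> (scurve \<Rightarrow> real) \<Rightarrow> scurve \<Rightarrow> scurve \<Rightarrow> bool" where
  "is_hgrad \<Omega> H c X \<longleftrightarrow> is_ham \<Omega> H c X \<and> (\<forall>\<theta>. X \<theta> \<bullet> Ds c c \<theta> = 0)"

(* The same when the kernel is larger: orthogonality to the whole kernel is required. *)
definition is_hgrad_ker ::
    "(scurve \<Rightarrow> scurve \<Rightarrow> scurve \<Rightarrow> real) \<Rightarrow> (scurve \<Rightarrow> real) \<Rightarrow> scurve \<Rightarrow> scurve \<Rightarrow> bool" where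
  "is_hgrad_ker \<Omega> H c X \<longleftrightarrow> is_ham \<Omega> H c X \<and> X \<in> orth_compl c (ker_form \<Omega> c)"

(* The sign of the last term is opposite to the printed formula, which is incorrect: for H = len
   the gradient is g = - D_s^2 c, and i_X Omega = d len holds for X = D_s c x D_s^2 c / (3 Phi + Phi' len),
   whereas a plus sign would give the factor (1 + Phi' len / (3 Phi + Phi' len)) / (3 Phi). *)
definition hgrad_formula :: "(real \<Rightarrow> real) \<Rightarrow> scurve \<Rightarrow> scurve \<Rightarrow> scurve" where
  "hgrad_formula \<Phi> c g = (\<lambda>\<theta>.
     (1 / (3 * \<Phi> (len c))) *\<^sub>R
       (- (Ds c c \<times>\<^sub>3 g) \<theta>
        + (deriv \<Phi> (len c) / (3 * \<Phi> (len c) + deriv \<Phi> (len c) * len c)) *\<^sub>R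
            (G_id c (Ds c (Ds c c)) (Ds c c \<times>\<^sub>3 g) *\<^sub>R (Ds c c \<times>\<^sub>3 (Ds c c \<times>\<^sub>3 c)) \<theta>
             - G_id c c g *\<^sub>R (Ds c c \<times>\<^sub>3 Ds c (Ds c c)) \<theta>)))"

end

(* Integrating by parts turns Omega^Phi into G^id composed with an explicit operator: with T = D_s c
   and kappa = D_s^2 c,
     Omega^Phi(h, k) = G(3 Phi T x h - Phi' G(c x T, h) kappa + Phi' G(kappa, h) c x T, k),
   so the Hamilton equation is a pointwise equation for X which involves X also through the two numbers
   G(c x T, X) and G(kappa, X). Since grad H is orthogonal to T, applying T x solves it for the normal
   part of X. Pairing the solution with c x T and kappa, where the integrals of <c x T, T x kappa> and
   <kappa, T x (T x c)> are both the length l, leaves two decoupled scalar equations with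
   coefficient 3 Phi + Phi' l. If this coefficient vanishes, both numbers are free, which gives the
   two extra kernel directions c and T x kappa. *)

theory Submission
  imports Defs
begin

subsection \<open>Closure properties of smooth maps\<close>

text \<open>\<open>Csm\<close> with \<open>G_id\<close> is an inner product space that is not
  complete, so neither representing fields nor orthogonal projections come for abstract reasons:
  each is exhibited by a formula whose smoothness has to be checked. Definiteness of
  \<open>G_id\<close> suffices to turn an identity of forms into an identity of fields. The kernel
  in the degenerate case is infinite-dimensional, yet projecting off it is elementary: the
  tangential fields are handled pointwise, and only two normal directions remain. About
  \<open>H\<close>, only differentiability along smooth paths is known. Each symmetry is therefore
  used through a path on which \<open>H\<close> is constant, whose velocity is then orthogonal to
  the gradient. Reparametrizations make the gradient normal to the curve. In the degenerate case the
  two flows make the numbers G(c x T, X) and G(kappa, X) vanish for X = - T x grad H / (3 Phi), so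
  that this X itself solves the Hamilton equation.\<close>

lemma higher_diff_on_cong:
  assumes "open S" "higher_diff_on S n f" "\<And>x. x \<in> S \<Longrightarrow> f x = g x"
  shows "higher_diff_on S n g"
  using assms(2,3)
proof (induction n arbitrary: f g)
  case 0
  then show ?case by (simp cong: continuous_on_cong)
next
  case (Suc n)
  have D: "(g has_derivative frechet_derivative f (at x)) (at x)" if "x \<in> S" for x
    using Suc.prems that \<open>open S\<close>
    by (metis frechet_derivative_works has_derivative_transform_within_open higher_diff_on.simps(2))
  show ?case
    unfolding higher_diff_on.simps
  proof (intro conjI ballI allI)
    show "g differentiable (at x)" if "x \<in> S" for x
      using D[OF that] by (auto simp: differentiable_def)
    show "higher_diff_on S n (\<lambda>x. frechet_derivative g (at x) v)" for v
      by (rule Suc.IH[of "\<lambda>x. frechet_derivative f (at x) v"])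
        (use Suc.prems frechet_derivative_at[OF D] in auto)
  qed
qed

text \<open>\<open>frechet_derivative\<close> is a choice operator; since derivatives are unique,
  any explicit family \<open>f'\<close> may take its place. The inductive steps of the closure
  lemmas below go through this rule.\<close>

lemma higher_diff_on_SucI:
  assumes "\<And>x. x \<in> S \<Longrightarrow> (f has_derivative f' x) (at x)"
    and "\<And>v. higher_diff_on S n (\<lambda>x. f' x v)"
    and "open S"
  shows "higher_diff_on S (Suc n) f"
proof -
  have "f' x v = frechet_derivative f (at x) v" if "x \<in> S" for x v
    using frechet_derivative_at[OF assms(1)[OF that]] by simp
  then have "higher_diff_on S n (\<lambda>x. frechet_derivative f (at x) v)" for v
    by (rule higher_diff_on_cong[OF assms(3,2)])
  then show ?thesis
    using assms(1) by (auto simp: differentiable_def)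
qed

lemma higher_diff_on_mono: "higher_diff_on S (Suc n) f \<Longrightarrow> higher_diff_on S n f"
  by (induction n arbitrary: f)
    (auto intro!: continuous_at_imp_continuous_on differentiable_imp_continuous_within)

lemma higher_diff_on_SucD:
  "higher_diff_on S (Suc n) f \<Longrightarrow> x \<in> S \<Longrightarrow> (f has_derivative frechet_derivative f (at x)) (at x)"
  by (simp add: frechet_derivative_works)

lemma higher_diff_on_const: "open S \<Longrightarrow> higher_diff_on S n (\<lambda>x. k)"
proof (induction n arbitrary: k)
  case (Suc n)
  show ?case
    by (rule higher_diff_on_SucI[where f' = "\<lambda>x v. 0"]) (use Suc in auto)
qed simp

lemma higher_diff_on_linear:
  assumes "bounded_linear L" "open S" "higher_diff_on S n f"
  shows "higher_diff_on S n (\<lambda>x. L (f x))"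
  using assms(3)
proof (induction n arbitrary: f)
  case 0
  then show ?case using assms(1) by (simp add: bounded_linear.continuous_on)
next
  case (Suc n)
  show ?case
    by (rule higher_diff_on_SucI[where f' = "\<lambda>x v. L (frechet_derivative f (at x) v)"])
      (use Suc assms(1,2) in \<open>auto intro!: bounded_linear.has_derivative[OF assms(1)] higher_diff_on_SucD[OF Suc.prems]\<close>)
qed

lemma higher_diff_on_add:
  assumes "open S" "higher_diff_on S n f" "higher_diff_on S n g"
  shows "higher_diff_on S n (\<lambda>x. f x + g x)"
  using assms(2,3)
proof (induction n arbitrary: f g)
  case 0
  then show ?case by (simp add: continuous_on_add)
next
  case (Suc n)
  show ?case
    by (rule higher_diff_on_SucI
          [where f' = "\<lambda>x v. frechet_derivative f (at x) v + frechet_derivative g (at x) v"])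
      (use Suc assms(1) in \<open>auto intro!: has_derivative_add
          higher_diff_on_SucD[OF Suc.prems(1)] higher_diff_on_SucD[OF Suc.prems(2)]\<close>)
qed

text \<open>The product rule pairs each factor with the derivative of the other, so in the inductive
  step the undifferentiated factor has to be lowered by one order with
  \<open>higher_diff_on_mono\<close>. Inner, scalar and cross products are all instances.\<close>

lemma higher_diff_on_bilinear:
  assumes "bounded_bilinear B" "open S" "higher_diff_on S n f" "higher_diff_on S n g"
  shows "higher_diff_on S n (\<lambda>x. B (f x) (g x))"
  using assms(3,4)
proof (induction n arbitrary: f g)
  case 0
  then show ?case using assms(1) by (simp add: bounded_bilinear.continuous_on)
next
  case (Suc n)
  show ?case
  proof (rule higher_diff_on_SucI)
    show "((\<lambda>x. B (f x) (g x)) has_derivative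
        (\<lambda>v. B (f x) (frechet_derivative g (at x) v) + B (frechet_derivative f (at x) v) (g x))) (at x)"
      if "x \<in> S" for x
      by (intro bounded_bilinear.FDERIV[OF assms(1)] higher_diff_on_SucD[OF Suc.prems(1)]
          higher_diff_on_SucD[OF Suc.prems(2)] that)
    show "higher_diff_on S n
        (\<lambda>x. B (f x) (frechet_derivative g (at x) v) + B (frechet_derivative f (at x) v) (g x))" for v
      by (intro higher_diff_on_add Suc.IH assms(2))
        (use Suc.prems[THEN higher_diff_on_mono] Suc.prems in auto)
  qed fact
qed

text \<open>For a real inner function, the derivative of the composite in direction v is a scalar
  times one function \<open>h'\<close> at \<open>f x\<close>, so the induction runs over
  \<open>h\<close> with \<open>f\<close> fixed. Only this case arises: powers of the squared speed,
  reparametrizations, and functions of a moving angle.\<close>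

lemma higher_diff_on_compose_real:
  fixes f :: "'a::real_normed_vector \<Rightarrow> real"
  assumes "open S" "f ` S \<subseteq> T" "higher_diff_on S n f" "higher_diff_on T n h"
  shows "higher_diff_on S n (\<lambda>x. h (f x))"
  using assms(3,4)
proof (induction n arbitrary: h)
  case 0
  then show ?case using assms(2) by (auto intro: continuous_on_compose2)
next
  case (Suc n)
  define h' where "h' y = frechet_derivative h (at y) 1" for y
  show ?case
  proof (rule higher_diff_on_SucI)
    show "((\<lambda>x. h (f x)) has_derivative (\<lambda>v. frechet_derivative f (at x) v *\<^sub>R h' (f x))) (at x)"
      if "x \<in> S" for x
    proof -
      have h: "(h has_derivative frechet_derivative h (at (f x))) (at (f x))"
        using higher_diff_on_SucD[OF Suc.prems(2)] that assms(2) by auto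
      have "frechet_derivative h (at (f x)) r = r *\<^sub>R h' (f x)" for r
        using linear_cmul[OF has_derivative_linear[OF h], of r 1] by (simp add: h'_def)
      then show ?thesis
        using diff_chain_at[OF higher_diff_on_SucD[OF Suc.prems(1) that] h] by (simp add: o_def)
    qed
    have "higher_diff_on S n (\<lambda>x. h' (f x))"
      unfolding h'_def using Suc.prems(2)
      by (intro Suc.IH[of "\<lambda>y. frechet_derivative h (at y) 1"] higher_diff_on_mono[OF Suc.prems(1)]) simp
    then show "higher_diff_on S n (\<lambda>x. frechet_derivative f (at x) v *\<^sub>R h' (f x))" for v
      using Suc.prems(1) by (intro higher_diff_on_bilinear[OF bounded_bilinear_scaleR assms(1)]) auto
  qed fact
qed

lemma higher_diff_on_powr: "higher_diff_on {0<..} n (\<lambda>x::real. x powr p)"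
proof (induction n arbitrary: p)
  case 0
  show ?case by (auto intro!: continuous_intros)
next
  case (Suc n)
  show ?case
  proof (rule higher_diff_on_SucI)
    show "((\<lambda>x. x powr p) has_derivative (\<lambda>v. p * v *\<^sub>R x powr (p - 1))) (at x)"
      if "x \<in> {0<..}" for x
      by (rule has_derivative_eq_rhs[OF has_real_derivative_powr[unfolded has_field_derivative_def]])
        (use that in \<open>auto simp: fun_eq_iff\<close>)
    show "higher_diff_on {0<..} n (\<lambda>x. p * v *\<^sub>R x powr (p - 1))" for v
      using higher_diff_on_linear[OF bounded_linear_mult_right[of "p * v"] _ Suc.IH[of "p - 1"]]
      by (simp add: mult.assoc)
  qed simp
qed

lemma smooth_on_const: "open S \<Longrightarrow> smooth_on S (\<lambda>x. k)"
  by (simp add: smooth_on_def higher_diff_on_const)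

lemma smooth_on_linear:
  "bounded_linear L \<Longrightarrow> open S \<Longrightarrow> smooth_on S f \<Longrightarrow> smooth_on S (\<lambda>x. L (f x))"
  by (simp add: smooth_on_def higher_diff_on_linear)

lemma smooth_on_add:
  "open S \<Longrightarrow> smooth_on S f \<Longrightarrow> smooth_on S g \<Longrightarrow> smooth_on S (\<lambda>x. f x + g x)"
  by (simp add: smooth_on_def higher_diff_on_add)

lemma smooth_on_bilinear:
  "bounded_bilinear B \<Longrightarrow> open S \<Longrightarrow> smooth_on S f \<Longrightarrow> smooth_on S g
    \<Longrightarrow> smooth_on S (\<lambda>x. B (f x) (g x))"
  by (simp add: smooth_on_def higher_diff_on_bilinear)

lemma smooth_on_compose_real:
  fixes f :: "'a::real_normed_vector \<Rightarrow> real"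
  shows "open S \<Longrightarrow> f ` S \<subseteq> T \<Longrightarrow> smooth_on S f \<Longrightarrow> smooth_on T h \<Longrightarrow> smooth_on S (\<lambda>x. h (f x))"
  unfolding smooth_on_def using higher_diff_on_compose_real by blast

lemma smooth_on_id: "open S \<Longrightarrow> smooth_on S (\<lambda>x. x)"
  unfolding smooth_on_def
proof
  fix n
  assume S: "open S"
  show "higher_diff_on S n (\<lambda>x. x)"
  proof (cases n)
    case (Suc m)
    show ?thesis
      unfolding Suc
      by (rule higher_diff_on_SucI[where f' = "\<lambda>x v. v"]) (use S in \<open>auto intro: higher_diff_on_const\<close>)
  qed simp
qed

lemma smooth_on_has_derivative:
  "smooth_on S f \<Longrightarrow> x \<in> S \<Longrightarrow> (f has_derivative frechet_derivative f (at x)) (at x)"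
  by (meson higher_diff_on_SucD smooth_on_def)

lemma smooth_on_has_vector_derivative:
  "smooth_on S f \<Longrightarrow> x \<in> S \<Longrightarrow> (f has_vector_derivative vector_derivative f (at x)) (at x)"
  for f :: "real \<Rightarrow> 'a::real_normed_vector"
  using smooth_on_has_derivative vector_derivative_works by (metis differentiable_def)

lemma smooth_on_vector_derivative:
  fixes f :: "real \<Rightarrow> 'a::real_normed_vector"
  assumes "smooth_on S f" "open S"
  shows "smooth_on S (\<lambda>x. vector_derivative f (at x))"
  unfolding smooth_on_def
proof
  fix n
  have "higher_diff_on S n (\<lambda>x. frechet_derivative f (at x) 1)"
    using assms(1) unfolding smooth_on_def by (metis higher_diff_on.simps(2))
  moreover have "frechet_derivative f (at x) 1 = vector_derivative f (at x)" if "x \<in> S" for x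
    using smooth_on_has_derivative[OF assms(1) that]
      frechet_derivative_at[OF smooth_on_has_vector_derivative[OF assms(1) that, unfolded has_vector_derivative_def]]
    by (metis scaleR_one)
  ultimately show "higher_diff_on S n (\<lambda>x. vector_derivative f (at x))"
    by (rule higher_diff_on_cong[OF assms(2)])
qed

subsection \<open>Smooth periodic functions\<close>

lemma CsmI: "smooth_on UNIV f \<Longrightarrow> (\<And>\<theta>. f (\<theta> + 2 * pi) = f \<theta>) \<Longrightarrow> f \<in> Csm"
  by (simp add: Csm_def)

lemma Csm_const: "(\<lambda>\<theta>. k) \<in> Csm"
  by (simp add: Csm_def smooth_on_const)

lemma Csm_linear: "bounded_linear L \<Longrightarrow> f \<in> Csm \<Longrightarrow> (\<lambda>\<theta>. L (f \<theta>)) \<in> Csm"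
  by (simp add: Csm_def smooth_on_linear)

lemma Csm_add: "f \<in> Csm \<Longrightarrow> g \<in> Csm \<Longrightarrow> (\<lambda>\<theta>. f \<theta> + g \<theta>) \<in> Csm"
  by (simp add: Csm_def smooth_on_add)

lemma Csm_bilinear: "bounded_bilinear B \<Longrightarrow> f \<in> Csm \<Longrightarrow> g \<in> Csm \<Longrightarrow> (\<lambda>\<theta>. B (f \<theta>) (g \<theta>)) \<in> Csm"
  by (simp add: Csm_def smooth_on_bilinear)

lemma Csm_minus: "f \<in> Csm \<Longrightarrow> (\<lambda>\<theta>. - f \<theta>) \<in> Csm"
  by (rule Csm_linear[OF bounded_linear_minus[OF bounded_linear_ident]])

lemma Csm_diff: "f \<in> Csm \<Longrightarrow> g \<in> Csm \<Longrightarrow> (\<lambda>\<theta>. f \<theta> - g \<theta>) \<in> Csm"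
  using Csm_add[OF _ Csm_minus] by fastforce

lemma Csm_inner: "f \<in> Csm \<Longrightarrow> g \<in> Csm \<Longrightarrow> (\<lambda>\<theta>. f \<theta> \<bullet> g \<theta>) \<in> Csm"
  by (rule Csm_bilinear[OF bounded_bilinear_inner])

lemma Csm_scaleR: "f \<in> Csm \<Longrightarrow> g \<in> Csm \<Longrightarrow> (\<lambda>\<theta>. f \<theta> *\<^sub>R g \<theta>) \<in> Csm"
  by (rule Csm_bilinear[OF bounded_bilinear_scaleR])

lemma Csm_mult: "f \<in> Csm \<Longrightarrow> g \<in> Csm \<Longrightarrow> (\<lambda>\<theta>. f \<theta> * g \<theta> :: real) \<in> Csm"
  by (rule Csm_bilinear[OF bounded_bilinear_mult])

lemma bounded_bilinear_cross3: "bounded_bilinear cross3"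
  using bilinear_cross bilinear_conv_bounded_bilinear by blast

lemma Csm_cross3: "f \<in> Csm \<Longrightarrow> g \<in> Csm \<Longrightarrow> (\<lambda>\<theta>. cross3 (f \<theta>) (g \<theta>)) \<in> Csm"
  by (rule Csm_bilinear[OF bounded_bilinear_cross3])

lemmas Csm_intros = Csm_const Csm_add Csm_minus Csm_diff Csm_inner Csm_scaleR Csm_mult Csm_cross3

lemma Csm_has_vector_derivative: "f \<in> Csm \<Longrightarrow> (f has_vector_derivative dth f \<theta>) (at \<theta>)"
  by (simp add: Csm_def dth_def smooth_on_has_vector_derivative[of UNIV])

lemma Csm_periodic: "f \<in> Csm \<Longrightarrow> f (\<theta> + 2 * pi) = f \<theta>"
  by (simp add: Csm_def)

lemma Csm_continuous: "f \<in> Csm \<Longrightarrow> continuous_on S f"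
  by (metis (mono_tags, lifting) Csm_def continuous_on_subset higher_diff_on.simps(1) mem_Collect_eq
      smooth_on_def subset_UNIV)

lemma Csm_integrable: "f \<in> Csm \<Longrightarrow> f integrable_on {a..b}" for f :: "real \<Rightarrow> real"
  by (intro integrable_continuous_real Csm_continuous)

lemma Csm_vector_derivative: "f \<in> Csm \<Longrightarrow> (\<lambda>\<theta>. vector_derivative f (at \<theta>)) \<in> Csm"
proof (rule CsmI)
  assume f: "f \<in> Csm"
  then have D: "(f has_vector_derivative vector_derivative f (at \<theta>)) (at \<theta>)" for \<theta>
    by (simp add: Csm_def smooth_on_has_vector_derivative[of UNIV])
  show "smooth_on UNIV (\<lambda>\<theta>. vector_derivative f (at \<theta>))"
    using f by (simp add: Csm_def smooth_on_vector_derivative)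
  fix \<theta> :: real
  have "((\<lambda>x. f (x + 2 * pi)) has_vector_derivative vector_derivative f (at (\<theta> + 2 * pi))) (at \<theta>)"
    using vector_diff_chain_at[of "\<lambda>x. x + 2 * pi" 1 \<theta> f, OF _ D]
    by (simp add: o_def has_vector_derivative_add_const has_vector_derivative_id)
  then have "(f has_vector_derivative vector_derivative f (at (\<theta> + 2 * pi))) (at \<theta>)"
    using f by (simp add: Csm_periodic)
  then show "vector_derivative f (at (\<theta> + 2 * pi)) = vector_derivative f (at \<theta>)"
    by (metis vector_derivative_at)
qed

lemma Csm_dth: "f \<in> Csm \<Longrightarrow> dth f \<in> Csm"
  unfolding dth_def by (rule Csm_vector_derivative)

text \<open>Subtracts the integer part of \<theta> / (2 pi) periods. It carries bounds and pointwise
  vanishing from the compact interval of integration to the whole line.\<close>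

lemma periodic_reduce:
  assumes "\<And>\<theta>. f (\<theta> + 2 * pi) = f \<theta>"
  obtains t where "t \<in> {0..2 * pi}" "f t = f \<theta>"
proof -
  have n: "f (\<theta> + real n * (2 * pi)) = f \<theta>" for n \<theta>
    by (induction n) (use assms in \<open>simp_all add: algebra_simps, metis add.commute add.assoc\<close>)
  define k where "k = \<lfloor>\<theta> / (2 * pi)\<rfloor>"
  define t where "t = \<theta> - of_int k * (2 * pi)"
  have k: "of_int k \<le> \<theta> / (2 * pi)" "\<theta> / (2 * pi) < of_int k + 1"
    by (simp_all add: k_def)
  have "t \<in> {0..2 * pi}"
    using k by (simp add: t_def field_simps)
  moreover have "f t = f \<theta>"
  proof (cases "k \<ge> 0")
    case True
    then show ?thesis using n[of t "nat k"] by (simp add: t_def)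
  next
    case False
    then show ?thesis using n[of \<theta> "nat (- k)"] by (simp add: t_def)
  qed
  ultimately show ?thesis using that by blast
qed

lemma Csm_bounded:
  assumes "f \<in> Csm"
  obtains M where "M > 0" "\<And>\<theta>. norm (f \<theta>) \<le> M"
proof -
  have "bounded (f ` {0..2 * pi})"
    by (intro compact_imp_bounded compact_continuous_image Csm_continuous assms) auto
  then obtain M where M: "M > 0" "\<And>t. t \<in> {0..2 * pi} \<Longrightarrow> norm (f t) \<le> M"
    by (auto simp: bounded_pos)
  have "norm (f \<theta>) \<le> M" for \<theta>
    using periodic_reduce[of f \<theta>] M(2) Csm_periodic[OF assms] by metis
  with M(1) show ?thesis using that by blast
qed

lemma Imm_Csm: "c \<in> Imm \<Longrightarrow> c \<in> Csm"
  and Imm_dth: "c \<in> Imm \<Longrightarrow> dth c \<theta> \<noteq> 0"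
  by (auto simp: Imm_def)

lemma norm_powr: "norm x powr (2 * p) = (x \<bullet> x) powr p"
  by (simp add: norm_eq_sqrt_inner powr_half_sqrt[symmetric] powr_powr)

lemma Csm_powr:
  fixes f :: "real \<Rightarrow> real"
  assumes "f \<in> Csm" "\<And>\<theta>. f \<theta> > 0"
  shows "(\<lambda>\<theta>. f \<theta> powr p) \<in> Csm"
proof (rule CsmI)
  show "smooth_on UNIV (\<lambda>\<theta>. f \<theta> powr p)"
    by (rule smooth_on_compose_real[where T = "{0<..}" and h = "\<lambda>x. x powr p"])
      (use assms in \<open>auto simp: Csm_def smooth_on_def[of "{0<..}"] higher_diff_on_powr\<close>)
qed (use assms in \<open>simp add: Csm_periodic\<close>)

text \<open>The norm is not smooth at 0. The speed and its inverse are instead the powers 1/2 and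
  -1/2 of the squared speed, which is smooth and, for an immersion, positive.\<close>

lemma Csm_norm_dth:
  assumes "c \<in> Imm"
  shows "(\<lambda>\<theta>. norm (dth c \<theta>)) \<in> Csm" "(\<lambda>\<theta>. inverse (norm (dth c \<theta>))) \<in> Csm"
proof -
  have *: "(\<lambda>\<theta>. norm (dth c \<theta>) powr (2 * p)) \<in> Csm" for p
    unfolding norm_powr using assms
    by (intro Csm_powr Csm_inner Csm_dth) (auto simp: Imm_Csm Imm_dth)
  show "(\<lambda>\<theta>. norm (dth c \<theta>)) \<in> Csm" "(\<lambda>\<theta>. inverse (norm (dth c \<theta>))) \<in> Csm"
    using *[of "1/2"] *[of "-1/2"] Imm_dth[OF assms] by (simp_all add: powr_minus)
qed

lemma Csm_Ds: "c \<in> Imm \<Longrightarrow> f \<in> Csm \<Longrightarrow> Ds c f \<in> Csm"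
  unfolding Ds_def by (intro Csm_scaleR Csm_dth Csm_norm_dth)

section \<open>Integration by parts on the circle and derivatives of cross products and
  lines\<close>

lemma integral_periodic_derivative:
  fixes F :: "real \<Rightarrow> real"
  assumes "\<And>\<theta>. (F has_vector_derivative F' \<theta>) (at \<theta>)" "F (2 * pi) = F 0"
  shows "integral {0..2 * pi} F' = 0"
proof -
  have "(F' has_integral F (2 * pi) - F 0) {0..2 * pi}"
    by (rule fundamental_theorem_of_calculus) (auto intro: has_vector_derivative_at_within assms)
  with assms(2) show ?thesis by (simp add: integral_unique)
qed

lemma Csm_integral_parts:
  assumes "f \<in> Csm" "h \<in> Csm"
  shows "integral {0..2 * pi} (\<lambda>\<theta>. dth f \<theta> \<bullet> h \<theta>) = - integral {0..2 * pi} (\<lambda>\<theta>. f \<theta> \<bullet> dth h \<theta>)"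
proof -
  have "integral {0..2 * pi} (\<lambda>\<theta>. f \<theta> \<bullet> dth h \<theta> + dth f \<theta> \<bullet> h \<theta>) = 0"
  proof (rule integral_periodic_derivative)
    show "((\<lambda>\<theta>. f \<theta> \<bullet> h \<theta>) has_vector_derivative f \<theta> \<bullet> dth h \<theta> + dth f \<theta> \<bullet> h \<theta>) (at \<theta>)" for \<theta>
      by (rule bounded_bilinear.has_vector_derivative[OF bounded_bilinear_inner])
        (use assms in \<open>auto intro: Csm_has_vector_derivative\<close>)
    show "f (2 * pi) \<bullet> h (2 * pi) = f 0 \<bullet> h 0"
      using Csm_periodic[of f 0] Csm_periodic[of h 0] assms by simp
  qed
  moreover have "integral {0..2 * pi} (\<lambda>\<theta>. f \<theta> \<bullet> dth h \<theta> + dth f \<theta> \<bullet> h \<theta>)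
      = integral {0..2 * pi} (\<lambda>\<theta>. f \<theta> \<bullet> dth h \<theta>) + integral {0..2 * pi} (\<lambda>\<theta>. dth f \<theta> \<bullet> h \<theta>)"
    by (intro integral_add Csm_integrable Csm_inner Csm_dth assms)
  ultimately show ?thesis by simp
qed

lemma dth_cross:
  assumes "f \<in> Csm" "h \<in> Csm"
  shows "dth (\<lambda>\<theta>. cross3 (f \<theta>) (h \<theta>)) \<theta> = cross3 (f \<theta>) (dth h \<theta>) + cross3 (dth f \<theta>) (h \<theta>)"
  unfolding dth_def
  by (intro vector_derivative_at bounded_bilinear.has_vector_derivative[OF bounded_bilinear_cross3])
    (use assms Csm_has_vector_derivative in \<open>auto simp: dth_def\<close>)

lemma dth_add_scaleR:
  assumes "f \<in> Csm" "h \<in> Csm"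
  shows "dth (\<lambda>\<theta>. f \<theta> + t *\<^sub>R h \<theta>) \<theta> = dth f \<theta> + t *\<^sub>R dth h \<theta>"
  unfolding dth_def
  by (intro vector_derivative_at derivative_intros)
    (use assms Csm_has_vector_derivative in \<open>auto simp: dth_def intro!: derivative_eq_intros\<close>)

subsection \<open>The metric\<close>

lemma G_id_commute: "G_id c h k = G_id c k h"
  by (simp add: G_id_def inner_commute)

lemma G_id_integrable:
  assumes "c \<in> Imm" "h \<in> Csm" "k \<in> Csm"
  shows "(\<lambda>\<theta>. h \<theta> \<bullet> k \<theta> * norm (dth c \<theta>)) integrable_on {0..2 * pi}"
  by (intro Csm_integrable Csm_mult Csm_inner Csm_norm_dth assms)

lemma G_id_add:
  assumes "c \<in> Imm" "h \<in> Csm" "h' \<in> Csm" "k \<in> Csm"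
  shows "G_id c (\<lambda>\<theta>. h \<theta> + h' \<theta>) k = G_id c h k + G_id c h' k"
  unfolding G_id_def int_ds_def inner_add_left distrib_right
  by (intro integral_add G_id_integrable assms)

lemma G_id_scaleR: "G_id c (\<lambda>\<theta>. r *\<^sub>R h \<theta>) k = r * G_id c h k"
  by (simp add: G_id_def int_ds_def mult.assoc)

lemma G_id_minus: "G_id c (\<lambda>\<theta>. - h \<theta>) k = - G_id c h k"
  using G_id_scaleR[of c "-1" h k] by simp

lemma G_id_diff:
  assumes "c \<in> Imm" "h \<in> Csm" "h' \<in> Csm" "k \<in> Csm"
  shows "G_id c (\<lambda>\<theta>. h \<theta> - h' \<theta>) k = G_id c h k - G_id c h' k"
  using G_id_add[OF assms(1,2) Csm_minus[OF assms(3)] assms(4)] by (simp add: G_id_minus)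

lemmas G_id_linear_left = G_id_add G_id_scaleR G_id_minus G_id_diff

text \<open>A continuous nonnegative function with integral 0 vanishes on the interval; the speed is
  nonzero, so the factor \<open>h \<bullet> h\<close> is the one that vanishes.\<close>

lemma G_id_definite:
  assumes "c \<in> Imm" "h \<in> Csm" "G_id c h h = 0"
  shows "h = (\<lambda>\<theta>. 0)"
proof
  fix \<theta>
  obtain t where t: "t \<in> {0..2 * pi}" "h t = h \<theta>"
    using periodic_reduce[of h] Csm_periodic[OF assms(2)] by blast
  have "\<forall>t\<in>{0..2 * pi}. h t \<bullet> h t * norm (dth c t) = 0"
    using assms(3) unfolding G_id_def int_ds_def
    by (subst (asm) integral_eq_0_iff)
      (auto intro!: Csm_continuous Csm_mult Csm_inner Csm_norm_dth assms)
  then show "h \<theta> = 0" using Imm_dth[OF assms(1)] t by simp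
qed

text \<open>Test with the difference of the two fields. This is the only form of nondegeneracy used
  to pass from a form to the field representing it.\<close>

lemma G_id_eqI:
  assumes "c \<in> Imm" "h \<in> Csm" "h' \<in> Csm" "\<And>k. k \<in> Csm \<Longrightarrow> G_id c h k = G_id c h' k"
  shows "h = h'"
proof -
  have d: "(\<lambda>\<theta>. h \<theta> - h' \<theta>) \<in> Csm" by (intro Csm_diff assms)
  then have "G_id c (\<lambda>\<theta>. h \<theta> - h' \<theta>) (\<lambda>\<theta>. h \<theta> - h' \<theta>) = 0"
    using G_id_diff[OF assms(1-3) d] assms(4)[OF d] by simp
  then show ?thesis using G_id_definite[OF assms(1) d] by (simp add: fun_eq_iff)
qed

text \<open>The speed in ds cancels the inverse speed in D_s, leaving an integration by parts in
  \<theta> without boundary terms.\<close>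

lemma G_id_Ds:
  assumes "c \<in> Imm" "f \<in> Csm" "h \<in> Csm"
  shows "G_id c (Ds c f) h = - G_id c f (Ds c h)"
  using Csm_integral_parts[OF assms(2,3)] Imm_dth[OF assms(1)]
  by (simp add: G_id_def int_ds_def Ds_def field_simps)

subsection \<open>Derivatives of the length and of the one-form\<close>

lemma Ds_inner_self: "c \<in> Imm \<Longrightarrow> Ds c c \<theta> \<bullet> Ds c c \<theta> = 1"
  using Imm_dth[of c \<theta>] by (simp add: Ds_def power2_norm_eq_inner[symmetric] power2_eq_square)

lemma curvature_orth_tangent:
  assumes "c \<in> Imm"
  shows "Ds c c \<theta> \<bullet> Ds c (Ds c c) \<theta> = 0"
proof -
  let ?T = "Ds c c"
  have T: "?T \<in> Csm" using assms by (intro Csm_Ds Imm_Csm)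
  have "((\<lambda>\<theta>. ?T \<theta> \<bullet> ?T \<theta>) has_vector_derivative ?T \<theta> \<bullet> dth ?T \<theta> + dth ?T \<theta> \<bullet> ?T \<theta>) (at \<theta>)"
    by (rule bounded_bilinear.has_vector_derivative[OF bounded_bilinear_inner])
      (use T in \<open>auto intro: Csm_has_vector_derivative\<close>)
  moreover have "((\<lambda>\<theta>. ?T \<theta> \<bullet> ?T \<theta>) has_vector_derivative 0) (at \<theta>)"
    using assms by (simp add: Ds_inner_self)
  ultimately have "?T \<theta> \<bullet> dth ?T \<theta> + dth ?T \<theta> \<bullet> ?T \<theta> = 0"
    by (rule vector_derivative_unique_at)
  then have "?T \<theta> \<bullet> dth ?T \<theta> = 0" by (simp add: inner_commute)
  then show ?thesis by (simp add: Ds_def[of c "Ds c c"])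
qed

lemma len_eq_G_id: "c \<in> Imm \<Longrightarrow> len c = G_id c (Ds c c) (Ds c c)"
  by (simp add: len_def G_id_def int_ds_def Ds_inner_self)

lemma len_pos:
  assumes "c \<in> Imm"
  shows "len c > 0"
proof -
  have "len c \<noteq> 0"
    using G_id_definite[OF assms, of "Ds c c"] Csm_Ds[OF assms Imm_Csm[OF assms]]
      len_eq_G_id[OF assms] Ds_inner_self[OF assms, of 0] by fastforce
  moreover have "len c \<ge> 0"
    unfolding len_def by (intro integral_nonneg Csm_integrable Csm_norm_dth assms) auto
  ultimately show ?thesis by simp
qed

lemma G_id_curvature_position:
  assumes "c \<in> Imm"
  shows "G_id c (Ds c (Ds c c)) c = - len c"
  using G_id_Ds[OF assms Csm_Ds[OF assms Imm_Csm[OF assms]] Imm_Csm[OF assms]] assms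
  by (simp add: len_eq_G_id)

text \<open>The inverse speed in D_s cancels against ds, also where the derivative of
  \<open>c\<close> vanishes. The formula thus holds for every \<open>c\<close>, and it is polynomial
  along a line of curves even where the line leaves \<open>Imm\<close>.\<close>

lemma Theta_id_eq: "Theta_id c h = integral {0..2 * pi} (\<lambda>\<theta>. cross3 (c \<theta>) (dth c \<theta>) \<bullet> h \<theta>)"
proof -
  have "cross3 (c \<theta>) (Ds c c \<theta>) \<bullet> h \<theta> * norm (dth c \<theta>) = cross3 (c \<theta>) (dth c \<theta>) \<bullet> h \<theta>" for \<theta>
    by (cases "dth c \<theta> = 0") (simp_all add: Ds_def cross_mult_right)
  then show ?thesis by (simp add: Theta_id_def int_ds_def fcross_def)
qed

text \<open>Along a line the one-form is a quadratic polynomial in t, so its derivative at 0 is read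
  off as the linear coefficient, without differentiating under the integral.\<close>

lemma Theta_id_has_derivative:
  assumes "c \<in> Csm" "h \<in> Csm" "k \<in> Csm"
  shows "((\<lambda>t. Theta_id (\<lambda>\<theta>. c \<theta> + t *\<^sub>R h \<theta>) k) has_real_derivative
    integral {0..2 * pi} (\<lambda>\<theta>. (cross3 (h \<theta>) (dth c \<theta>) + cross3 (c \<theta>) (dth h \<theta>)) \<bullet> k \<theta>)) (at 0)"
proof -
  let ?P = "\<lambda>\<theta>. cross3 (c \<theta>) (dth c \<theta>) \<bullet> k \<theta>"
    and ?Q = "\<lambda>\<theta>. (cross3 (h \<theta>) (dth c \<theta>) + cross3 (c \<theta>) (dth h \<theta>)) \<bullet> k \<theta>"
    and ?R = "\<lambda>\<theta>. cross3 (h \<theta>) (dth h \<theta>) \<bullet> k \<theta>"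
  have int: "?P integrable_on {0..2 * pi}" "?Q integrable_on {0..2 * pi}" "?R integrable_on {0..2 * pi}"
    by (intro Csm_integrable Csm_intros Csm_dth assms)+
  have "Theta_id (\<lambda>\<theta>. c \<theta> + t *\<^sub>R h \<theta>) k
      = integral {0..2 * pi} ?P + t * integral {0..2 * pi} ?Q + t\<^sup>2 * integral {0..2 * pi} ?R" for t
  proof -
    have "cross3 (c \<theta> + t *\<^sub>R h \<theta>) (dth (\<lambda>\<theta>. c \<theta> + t *\<^sub>R h \<theta>) \<theta>) \<bullet> k \<theta>
        = ?P \<theta> + t * ?Q \<theta> + t\<^sup>2 * ?R \<theta>" for \<theta>
      unfolding dth_add_scaleR[OF assms(1,2)]
      by (simp add: cross_add_left cross_add_right cross_mult_left cross_mult_right inner_add_left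
          power2_eq_square algebra_simps)
    then show ?thesis
      unfolding Theta_id_eq using int
      by (simp add: integral_add integrable_add integrable_on_mult_right)
  qed
  then show ?thesis
    by (auto intro!: derivative_eq_intros)
qed

section \<open>First variation of the length\<close>

lemma norm_line_has_derivative:
  fixes p q :: "'a::real_inner"
  assumes "p + x *\<^sub>R q \<noteq> 0"
  shows "((\<lambda>t. norm (p + t *\<^sub>R q)) has_real_derivative q \<bullet> sgn (p + x *\<^sub>R q)) (at x within U)"
proof -
  have "((\<lambda>t. norm (p + t *\<^sub>R q)) has_derivative (\<lambda>t. (t *\<^sub>R q) \<bullet> sgn (p + x *\<^sub>R q))) (at x within U)"
    by (rule has_derivative_compose[where g = norm and f = "\<lambda>t. p + t *\<^sub>R q", OF _ has_derivative_norm[OF assms]])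
      (auto intro!: derivative_eq_intros)
  then show ?thesis
    unfolding has_field_derivative_def by (rule has_derivative_eq_rhs) (simp add: fun_eq_iff)
qed

lemma len_has_derivative:
  assumes "c \<in> Imm" "h \<in> Csm"
  shows "((\<lambda>t. len (\<lambda>\<theta>. c \<theta> + t *\<^sub>R h \<theta>)) has_real_derivative - G_id c (Ds c (Ds c c)) h) (at 0)"
proof -
  let ?p = "dth c" and ?q = "dth h"
  have p: "?p \<in> Csm" and q: "?q \<in> Csm" and c: "c \<in> Csm" using assms by (auto intro: Csm_dth Imm_Csm)
  obtain m where m: "m > 0" "\<And>\<theta>. norm (inverse (norm (?p \<theta>))) \<le> m"
    using Csm_bounded[OF Csm_norm_dth(2)[OF assms(1)]] by blast
  obtain M where M: "M > 0" "\<And>\<theta>. norm (?q \<theta>) \<le> M"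
    using Csm_bounded[OF q] by blast
  \<comment> \<open>\<open>m\<close> bounds the inverse speed and \<open>M\<close> bounds the
    derivative of \<open>h\<close>. For |t| < 1 / (m M) the perturbation of \<open>dth c\<close> is
    shorter than 1 / m, hence shorter than \<open>dth c\<close>, and the norm is differentiated away
    from 0 only.\<close>
  define U where "U = ball (0::real) (1 / (m * M))"
  have U: "open U" "convex U" "0 \<in> U" using m M by (auto simp: U_def)
  have nz: "?p \<theta> + t *\<^sub>R ?q \<theta> \<noteq> 0" if "t \<in> U" for t \<theta>
  proof
    assume "?p \<theta> + t *\<^sub>R ?q \<theta> = 0"
    then have "norm (?p \<theta>) = \<bar>t\<bar> * norm (?q \<theta>)"
      by (metis add_eq_0_iff2 norm_minus_cancel norm_scaleR)
    also have "\<dots> \<le> \<bar>t\<bar> * M" using M by (simp add: mult_left_mono)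
    also have "\<dots> < 1 / m" using that m(1) M(1) by (simp add: U_def field_simps)
    finally have "norm (?p \<theta>) < 1 / m" .
    moreover have "norm (?p \<theta>) \<ge> 1 / m"
      using m(1) m(2)[of \<theta>] Imm_dth[OF assms(1), of \<theta>] by (simp add: field_simps)
    ultimately show False by simp
  qed
  have len: "len (\<lambda>\<theta>. c \<theta> + t *\<^sub>R h \<theta>) = integral (cbox 0 (2 * pi)) (\<lambda>\<theta>. norm (?p \<theta> + t *\<^sub>R ?q \<theta>))" for t
    by (simp add: len_def dth_add_scaleR[OF c assms(2)])
  have cont: "continuous_on S (\<lambda>x. f (snd x))" if "f \<in> Csm" for S :: "(real \<times> real) set" and f :: scurve
    by (rule continuous_on_compose2[OF Csm_continuous[OF that, of UNIV]]) (auto intro: continuous_intros)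
  have "((\<lambda>t. integral (cbox 0 (2 * pi)) (\<lambda>\<theta>. norm (?p \<theta> + t *\<^sub>R ?q \<theta>))) has_real_derivative
      integral (cbox 0 (2 * pi)) (\<lambda>\<theta>. ?q \<theta> \<bullet> sgn (?p \<theta> + 0 *\<^sub>R ?q \<theta>))) (at 0 within U)"
  proof (rule leibniz_rule_field_derivative)
    show "((\<lambda>t. norm (?p \<theta> + t *\<^sub>R ?q \<theta>)) has_real_derivative ?q \<theta> \<bullet> sgn (?p \<theta> + t *\<^sub>R ?q \<theta>)) (at t within U)"
      if "t \<in> U" for t \<theta>
      by (rule norm_line_has_derivative[OF nz[OF that]])
    show "(\<lambda>\<theta>. norm (?p \<theta> + t *\<^sub>R ?q \<theta>)) integrable_on cbox 0 (2 * pi)" for t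
      by (intro integrable_continuous continuous_intros Csm_continuous p q)
    show "continuous_on (U \<times> cbox 0 (2 * pi)) (\<lambda>(t, \<theta>). ?q \<theta> \<bullet> sgn (?p \<theta> + t *\<^sub>R ?q \<theta>))"
      unfolding case_prod_beta by (intro continuous_intros cont p q) (use nz in auto)
  qed (use U in auto)
  then have D: "((\<lambda>t. len (\<lambda>\<theta>. c \<theta> + t *\<^sub>R h \<theta>)) has_real_derivative
      integral {0..2 * pi} (\<lambda>\<theta>. ?q \<theta> \<bullet> sgn (?p \<theta>))) (at 0)"
    using at_within_open[OF U(3,1)] by (simp add: len)
  have "integral {0..2 * pi} (\<lambda>\<theta>. ?q \<theta> \<bullet> sgn (?p \<theta>)) = G_id c (Ds c h) (Ds c c)"
    using Imm_dth[OF assms(1)] by (simp add: G_id_def int_ds_def Ds_def sgn_div_norm field_simps)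
  also have "\<dots> = - G_id c (Ds c (Ds c c)) h"
    using G_id_Ds[OF assms(1) assms(2) Csm_Ds[OF assms(1) c]] by (simp add: G_id_commute)
  finally show ?thesis using D by simp
qed

lemma differential_len:
  "c \<in> Imm \<Longrightarrow> h \<in> Csm \<Longrightarrow> differential len c h = - G_id c (Ds c (Ds c c)) h"
  unfolding differential_def by (intro DERIV_imp_deriv len_has_derivative)

text \<open>The factor 3 has two sources: antisymmetrizing the derivative of the one-form gives - 2
  R pointwise, and the terms with derivatives of \<open>h\<close> and \<open>k\<close> combine to c
  paired with the derivative of h x k, which integrates by parts to one more - R.\<close>

lemma Omega_id_eq:
  assumes c: "c \<in> Imm" and h: "h \<in> Csm" and k: "k \<in> Csm"
  shows "Omega_id c h k = 3 * G_id c (Ds c c \<times>\<^sub>3 h) k"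
proof -
  let ?P = "\<lambda>h k \<theta>. (cross3 (h \<theta>) (dth c \<theta>) + cross3 (c \<theta>) (dth h \<theta>)) \<bullet> k \<theta>"
    and ?R = "\<lambda>\<theta>. cross3 (dth c \<theta>) (h \<theta>) \<bullet> k \<theta>"
    and ?Z = "\<lambda>\<theta>. c \<theta> \<bullet> dth (\<lambda>\<theta>. cross3 (h \<theta>) (k \<theta>)) \<theta>"
  note cc = Imm_Csm[OF c]
  have int: "?P h k integrable_on {0..2 * pi}" "?P k h integrable_on {0..2 * pi}"
    "?R integrable_on {0..2 * pi}" "?Z integrable_on {0..2 * pi}"
    by (intro Csm_integrable Csm_intros Csm_dth cc h k)+
  have PRZ: "?P h k \<theta> - ?P k h \<theta> = - 2 * ?R \<theta> + ?Z \<theta>" for \<theta>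
    unfolding dth_cross[OF h k] by (simp add: cross3_simps)
  have "integral {0..2 * pi} ?R = integral {0..2 * pi} (\<lambda>\<theta>. dth c \<theta> \<bullet> cross3 (h \<theta>) (k \<theta>))"
    by (simp add: cross3_simps)
  also have "\<dots> = - integral {0..2 * pi} ?Z"
    by (rule Csm_integral_parts[OF cc Csm_cross3[OF h k]])
  finally have RZ: "integral {0..2 * pi} ?R = - integral {0..2 * pi} ?Z" .
  have "integral {0..2 * pi} (?P h k) - integral {0..2 * pi} (?P k h)
      = integral {0..2 * pi} (\<lambda>\<theta>. ?P h k \<theta> - ?P k h \<theta>)"
    by (rule integral_diff[symmetric]) (rule int)+
  also have "\<dots> = integral {0..2 * pi} (\<lambda>\<theta>. - 2 * ?R \<theta> + ?Z \<theta>)"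
    by (simp only: PRZ)
  also have "\<dots> = - 2 * integral {0..2 * pi} ?R + integral {0..2 * pi} ?Z"
    using int by (simp add: integral_add integral_diff integrable_on_mult_right)
  finally have "ext_d Theta_id c h k = - 3 * integral {0..2 * pi} ?R"
    using Theta_id_has_derivative[OF cc h k] Theta_id_has_derivative[OF cc k h] RZ
    by (simp add: ext_d_def differential_def DERIV_imp_deriv)
  moreover have "integral {0..2 * pi} ?R = G_id c (Ds c c \<times>\<^sub>3 h) k"
    using Imm_dth[OF c]
    by (simp add: G_id_def int_ds_def fcross_def Ds_def cross_mult_left field_simps)
  ultimately show ?thesis by (simp add: Omega_id_def)
qed

lemma Theta_id_eq_G_id: "Theta_id c h = G_id c (c \<times>\<^sub>3 Ds c c) h"
  by (simp add: Theta_id_def G_id_def)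

text \<open>The product rule for the exterior derivative. The second summand is the wedge product of
  \<open>Theta_id\<close> with the differential of Phi(len), written out with \<open>len\<close>
  having the differential - G(kappa, .).\<close>

lemma Omega_Phi_eq:
  assumes c: "c \<in> Imm" and h: "h \<in> Csm" and k: "k \<in> Csm"
    and \<Phi>: "(\<Phi> has_real_derivative \<Phi>') (at (len c))"
  shows "Omega_Phi \<Phi> c h k = \<Phi> (len c) * Omega_id c h k
    + \<Phi>' * (G_id c (Ds c (Ds c c)) h * Theta_id c k - G_id c (Ds c (Ds c c)) k * Theta_id c h)"
proof -
  have "differential (\<lambda>c'. \<Phi> (len c') * Theta_id c' k) c h
      = \<Phi> (len c) * differential (\<lambda>c'. Theta_id c' k) c h
        - \<Phi>' * G_id c (Ds c (Ds c c)) h * Theta_id c k"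
    if h: "h \<in> Csm" and k: "k \<in> Csm" for h k
  proof -
    note \<Theta> = Theta_id_has_derivative[OF Imm_Csm[OF c] h k]
    have "((\<lambda>t. \<Phi> (len (\<lambda>\<theta>. c \<theta> + t *\<^sub>R h \<theta>))) has_real_derivative
        \<Phi>' * - G_id c (Ds c (Ds c c)) h) (at 0)"
      by (rule DERIV_chain2[OF _ len_has_derivative[OF c h]]) (use \<Phi> in simp)
    from DERIV_mult[OF this \<Theta>] show ?thesis
      unfolding differential_def DERIV_imp_deriv[OF \<Theta>]
      by (intro DERIV_imp_deriv) (simp add: algebra_simps)
  qed
  from this[OF h k] this[OF k h] show ?thesis
    unfolding Omega_Phi_def Omega_id_def ext_d_def by (simp add: algebra_simps)
qed

subsection \<open>Gradients of invariant functions\<close>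

lemma differential_path_constant:
  assumes "differentiable_Imm H c" "open J" "0 \<in> J" "smooth_path J \<gamma>" "\<gamma> 0 = c"
    and "\<And>t. t \<in> J \<Longrightarrow> H (\<gamma> t) = H c"
  shows "differential H c (velocity \<gamma> 0) = 0"
proof -
  have "((\<lambda>t. H (\<gamma> t)) has_real_derivative differential H c (velocity \<gamma> 0)) (at 0)"
    using assms unfolding differentiable_Imm_def by blast
  moreover have "((\<lambda>t. H (\<gamma> t)) has_real_derivative 0) (at 0)"
    by (rule has_field_derivative_transform_within_open[OF DERIV_const[of "H c"] assms(2,3)])
      (use assms in auto)
  ultimately show ?thesis by (rule DERIV_unique)
qed

text \<open>The flow line through \<open>c\<close> is a smooth path with initial velocity
  \<open>X c\<close> on which \<open>H\<close> is constant.\<close>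

lemma grad_orth_flow:
  assumes "is_grad_id H g" "flow_invariant X H" "c \<in> Imm" "X c \<in> Csm"
  shows "G_id c (g c) (X c) = 0"
proof -
  obtain J Fl where F: "is_flow X J Fl" "\<And>t. t \<in> J c \<Longrightarrow> H (Fl t c) = H c"
    using assms(2,3) unfolding flow_invariant_def by blast
  have "differential H c (velocity (\<lambda>t. Fl t c) 0) = 0"
    by (rule differential_path_constant[where J = "J c"])
      (use F assms(1,3) in \<open>auto simp: is_flow_def is_grad_id_def\<close>)
  moreover have "velocity (\<lambda>t. Fl t c) 0 = X c"
    using F(1) assms(3) by (auto simp: is_flow_def)
  ultimately show ?thesis using assms by (simp add: is_grad_id_def)
qed

lemma Imm_compose_DiffP:
  assumes "c \<in> Imm" "\<phi> \<in> DiffP"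
  shows "c \<circ> \<phi> \<in> Imm"
proof -
  have \<phi>: "smooth_on UNIV \<phi>" "\<And>\<theta>. deriv \<phi> \<theta> > 0" "\<And>\<theta>. \<phi> (\<theta> + 2 * pi) = \<phi> \<theta> + 2 * pi"
    using assms(2) by (auto simp: DiffP_def)
  have "(\<phi> has_vector_derivative deriv \<phi> \<theta>) (at \<theta>)" for \<theta>
    using smooth_on_has_derivative[OF \<phi>(1), of \<theta>]
    unfolding has_real_derivative_iff_has_vector_derivative[symmetric] DERIV_deriv_iff_real_differentiable
    by (metis UNIV_I differentiable_def)
  then have "dth (c \<circ> \<phi>) \<theta> = deriv \<phi> \<theta> *\<^sub>R dth c (\<phi> \<theta>)" for \<theta>
    unfolding dth_def[of "c \<circ> \<phi>"]
    by (intro vector_derivative_at vector_diff_chain_at Csm_has_vector_derivative Imm_Csm[OF assms(1)])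
  then have "dth (c \<circ> \<phi>) \<theta> \<noteq> 0" for \<theta>
    using \<phi>(2)[of \<theta>] Imm_dth[OF assms(1)] by simp
  moreover have "c \<circ> \<phi> \<in> Csm"
  proof (rule CsmI)
    show "smooth_on UNIV (c \<circ> \<phi>)"
      unfolding o_def by (rule smooth_on_compose_real[where T = UNIV])
        (use \<phi> Imm_Csm[OF assms(1)] in \<open>auto simp: Csm_def\<close>)
  qed (use \<phi>(3) Csm_periodic[OF Imm_Csm[OF assms(1)]] in auto)
  ultimately show ?thesis by (simp add: Imm_def)
qed

text \<open>The path \<open>\<theta> \<mapsto> \<theta> + t a(\<theta>)\<close> moves \<open>c\<close> with initial velocity \<open>a c\<^sub>\<theta>\<close>; then take
  \<open>a = \<langle>g, c\<^sub>\<theta>\<rangle>\<close>.\<close>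

lemma grad_orth_tangent:
  assumes "is_grad_id H g" "DiffP_invariant H" "c \<in> Imm"
  shows "Ds c c \<theta> \<bullet> g c \<theta> = 0"
proof -
  have g: "g c \<in> Csm" using assms by (simp add: is_grad_id_def)
  note c = Imm_Csm[OF assms(3)]
  define a where "a \<theta> = g c \<theta> \<bullet> dth c \<theta>" for \<theta>
  have a: "a \<in> Csm" unfolding a_def by (intro Csm_inner Csm_dth g c)
  obtain M where M: "M > 0" "\<And>\<theta>. norm (vector_derivative a (at \<theta>)) \<le> M"
    using Csm_bounded[OF Csm_vector_derivative[OF a]] by blast
  \<comment> \<open>\<open>M\<close> bounds the derivative of \<open>a\<close>, so for |t| < 1 / M
    the derivative 1 + t a' of the angle map is positive, which makes it a diffeomorphism of the
    circle.\<close>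
  define J where "J = ball (0::real) (1 / M)"
  define \<gamma> where "\<gamma> t = c \<circ> (\<lambda>\<theta>. \<theta> + t * a \<theta>)" for t
  have J: "open J" "0 \<in> J" using M by (auto simp: J_def)
  have aD: "(a has_real_derivative vector_derivative a (at \<theta>)) (at \<theta>)" for \<theta>
    using a by (simp add: has_real_derivative_iff_has_vector_derivative Csm_def
        smooth_on_has_vector_derivative[of UNIV])
  have \<phi>: "(\<lambda>\<theta>. \<theta> + t * a \<theta>) \<in> DiffP" if "t \<in> J" for t
    unfolding DiffP_def mem_Collect_eq
  proof (intro conjI allI)
    show "smooth_on UNIV (\<lambda>\<theta>. \<theta> + t * a \<theta>)"
      using a by (intro smooth_on_add smooth_on_id smooth_on_linear[OF bounded_linear_mult_right])
        (auto simp: Csm_def)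
    show "0 < deriv (\<lambda>\<theta>. \<theta> + t * a \<theta>) \<theta>" for \<theta>
    proof -
      have "((\<lambda>\<theta>. \<theta> + t * a \<theta>) has_real_derivative 1 + t * vector_derivative a (at \<theta>)) (at \<theta>)"
        by (auto intro!: derivative_eq_intros aD)
      then have "deriv (\<lambda>\<theta>. \<theta> + t * a \<theta>) \<theta> = 1 + t * vector_derivative a (at \<theta>)"
        by (rule DERIV_imp_deriv)
      moreover have "\<bar>t * vector_derivative a (at \<theta>)\<bar> < 1"
      proof -
        have "\<bar>t * vector_derivative a (at \<theta>)\<bar> \<le> \<bar>t\<bar> * M"
          using M(2)[of \<theta>] by (simp add: abs_mult mult_left_mono)
        also have "\<dots> < 1" using that M(1) by (simp add: J_def field_simps)
        finally show ?thesis .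
      qed
      ultimately show ?thesis by linarith
    qed
    show "\<theta> + 2 * pi + t * a (\<theta> + 2 * pi) = \<theta> + t * a \<theta> + 2 * pi" for \<theta>
      using Csm_periodic[OF a] by simp
  qed
  have "smooth_on (J \<times> UNIV) (\<lambda>p. c (snd p + fst p * a (snd p)))"
  proof (rule smooth_on_compose_real[where T = UNIV])
    have O: "open (J \<times> (UNIV :: real set))" using J by (simp add: open_Times)
    have fs: "smooth_on (J \<times> (UNIV :: real set)) (\<lambda>p. fst p)" "smooth_on (J \<times> (UNIV :: real set)) (\<lambda>p. snd p)"
      by (intro smooth_on_linear[OF bounded_linear_fst] smooth_on_linear[OF bounded_linear_snd]
          smooth_on_id O)+
    have "smooth_on (J \<times> (UNIV :: real set)) (\<lambda>p. a (snd p))"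
      by (rule smooth_on_compose_real[OF O, where T = UNIV]) (use fs a in \<open>auto simp: Csm_def\<close>)
    then show "smooth_on (J \<times> (UNIV :: real set)) (\<lambda>p. snd p + fst p * a (snd p))"
      using fs by (intro smooth_on_add smooth_on_bilinear[OF bounded_bilinear_mult] O)
    show "open (J \<times> (UNIV :: real set))" by (rule O)
  qed (use c in \<open>auto simp: Csm_def\<close>)
  then have "smooth_path J \<gamma>"
    using \<phi> Imm_compose_DiffP[OF assms(3)] by (simp add: smooth_path_def \<gamma>_def case_prod_unfold)
  then have "differential H c (velocity \<gamma> 0) = 0"
    by (rule differential_path_constant[rotated 3])
      (use J assms \<phi> in \<open>auto simp: is_grad_id_def \<gamma>_def DiffP_invariant_def o_def\<close>)
  moreover have "velocity \<gamma> 0 = (\<lambda>\<theta>. a \<theta> *\<^sub>R dth c \<theta>)"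
  proof
    fix \<theta>
    have "((c \<circ> (\<lambda>t. \<theta> + t * a \<theta>)) has_vector_derivative a \<theta> *\<^sub>R dth c (\<theta> + 0 * a \<theta>)) (at 0)"
      by (rule vector_diff_chain_at[OF _ Csm_has_vector_derivative[OF c]])
        (auto intro!: derivative_eq_intros)
    then show "velocity \<gamma> 0 \<theta> = a \<theta> *\<^sub>R dth c \<theta>"
      unfolding velocity_def \<gamma>_def by (intro vector_derivative_at) (simp add: o_def)
  qed
  moreover have "(\<lambda>\<theta>. a \<theta> *\<^sub>R dth c \<theta>) \<in> Csm" by (intro Csm_scaleR Csm_dth a c)
  ultimately have "G_id c (g c) (\<lambda>\<theta>. a \<theta> *\<^sub>R dth c \<theta>) = 0"
    using assms(1,3) by (simp add: is_grad_id_def)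
  \<comment> \<open>By the choice of \<open>a\<close>, the gradient paired with \<open>a\<close>
    times \<open>dth c\<close> is the square of \<open>a\<close>, so the vanishing integral has a
    nonnegative integrand.\<close>
  then have "integral {0..2 * pi} (\<lambda>\<theta>. (a \<theta>)\<^sup>2 * norm (dth c \<theta>)) = 0"
    by (simp add: G_id_def int_ds_def a_def power2_eq_square)
  moreover have "continuous_on {0..2 * pi} (\<lambda>\<theta>. (a \<theta>)\<^sup>2 * norm (dth c \<theta>))"
    by (intro continuous_intros Csm_continuous a Csm_dth c)
  ultimately have "\<forall>t\<in>{0..2 * pi}. (a t)\<^sup>2 * norm (dth c t) = 0"
    by (subst (asm) integral_eq_0_iff) auto
  moreover obtain t where "t \<in> {0..2 * pi}" "a t = a \<theta>"
    using periodic_reduce[of a] Csm_periodic[OF a] by blast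
  ultimately have "a \<theta> = 0" using Imm_dth[OF assms(3)] by fastforce
  then show ?thesis by (simp add: a_def Ds_def inner_commute)
qed

subsection \<open>The Hamilton equation\<close>

lemma Csm_fcross: "f \<in> Csm \<Longrightarrow> h \<in> Csm \<Longrightarrow> f \<times>\<^sub>3 h \<in> Csm"
  unfolding fcross_def by (rule Csm_cross3)

text \<open>The operator of the overview, with \<open>a\<close> for Phi and \<open>b\<close> for
  Phi' at the length. As independent numbers they let the degenerate case enter as the relation
  \<open>b * len c = - 3 * a\<close>.\<close>

definition omega_op :: "real \<Rightarrow> real \<Rightarrow> scurve \<Rightarrow> scurve \<Rightarrow> scurve" where
  "omega_op a b c h = (\<lambda>\<theta>. (3 * a) *\<^sub>R (Ds c c \<times>\<^sub>3 h) \<theta>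
     - (b * G_id c (c \<times>\<^sub>3 Ds c c) h) *\<^sub>R Ds c (Ds c c) \<theta>
     + (b * G_id c (Ds c (Ds c c)) h) *\<^sub>R (c \<times>\<^sub>3 Ds c c) \<theta>)"

lemma Csm_frame:
  assumes "c \<in> Imm"
  shows "Ds c c \<in> Csm" "Ds c (Ds c c) \<in> Csm" "c \<times>\<^sub>3 Ds c c \<in> Csm"
    "Ds c c \<times>\<^sub>3 Ds c (Ds c c) \<in> Csm" "Ds c c \<times>\<^sub>3 (Ds c c \<times>\<^sub>3 c) \<in> Csm"
  using assms Imm_Csm[OF assms] by (auto intro!: Csm_Ds Csm_fcross)

lemma Csm_omega_op: "c \<in> Imm \<Longrightarrow> h \<in> Csm \<Longrightarrow> omega_op a b c h \<in> Csm"
  unfolding omega_op_def by (intro Csm_intros Csm_fcross Csm_frame)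

lemma Omega_Phi_eq_G_id:
  assumes "c \<in> Imm" "h \<in> Csm" "k \<in> Csm" "(\<Phi> has_real_derivative \<Phi>') (at (len c))"
  shows "Omega_Phi \<Phi> c h k = G_id c (omega_op (\<Phi> (len c)) \<Phi>' c h) k"
proof -
  have "G_id c (omega_op (\<Phi> (len c)) \<Phi>' c h) k
     = 3 * \<Phi> (len c) * G_id c (Ds c c \<times>\<^sub>3 h) k
       - \<Phi>' * G_id c (c \<times>\<^sub>3 Ds c c) h * G_id c (Ds c (Ds c c)) k
       + \<Phi>' * G_id c (Ds c (Ds c c)) h * G_id c (c \<times>\<^sub>3 Ds c c) k"
    using assms Csm_frame[OF assms(1)] Csm_fcross[OF Csm_frame(1)[OF assms(1)] assms(2)]
    unfolding omega_op_def
    by (simp add: G_id_linear_left Csm_intros)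
  then show ?thesis
    unfolding Omega_Phi_eq[OF assms] Omega_id_eq[OF assms(1-3)] Theta_id_eq_G_id
    by (simp add: algebra_simps)
qed

text \<open>The form and its operator are kept abstract so that both \<open>Omega_Phi\<close> and
  \<open>Omega_MW\<close> fit. The equivalence rests on \<open>G_id_eqI\<close>.\<close>

lemma is_ham_iff:
  assumes "c \<in> Imm" "g \<in> Csm" "\<And>k. k \<in> Csm \<Longrightarrow> differential H c k = G_id c g k"
    and \<Omega>: "\<And>h k. h \<in> Csm \<Longrightarrow> k \<in> Csm \<Longrightarrow> \<Omega> c h k = G_id c (A h) k"
    and A: "\<And>h. h \<in> Csm \<Longrightarrow> A h \<in> Csm"
  shows "is_ham \<Omega> H c X \<longleftrightarrow> X \<in> Csm \<and> A X = g"
proof -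
  have "(\<forall>k\<in>Csm. \<Omega> c X k = differential H c k) \<longleftrightarrow> A X = g" if "X \<in> Csm"
    using \<Omega>[OF that] assms(3) G_id_eqI[OF assms(1) A[OF that] assms(2)] by metis
  then show ?thesis by (auto simp: is_ham_def)
qed

lemma ker_form_iff:
  assumes "c \<in> Imm"
    and \<Omega>: "\<And>h k. h \<in> Csm \<Longrightarrow> k \<in> Csm \<Longrightarrow> \<Omega> c h k = G_id c (A h) k"
    and A: "\<And>h. h \<in> Csm \<Longrightarrow> A h \<in> Csm"
  shows "h \<in> ker_form \<Omega> c \<longleftrightarrow> h \<in> Csm \<and> A h = (\<lambda>\<theta>. 0)"
proof -
  have 0: "G_id c (\<lambda>\<theta>. 0) k = 0" for k by (simp add: G_id_def int_ds_def)
  have "(\<forall>k\<in>Csm. \<Omega> c h k = 0) \<longleftrightarrow> A h = (\<lambda>\<theta>. 0)" if "h \<in> Csm"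
    using \<Omega>[OF that] 0 G_id_eqI[OF assms(1) A[OF that] Csm_const[of 0]] by metis
  then show ?thesis by (auto simp: ker_form_def)
qed

text \<open>Applying t x twice is minus the projection to the plane normal to t, so on that plane t
  x is inverted by its own negative.\<close>

lemma cross_cross_unit:
  "t \<bullet> t = 1 \<Longrightarrow> cross3 t (cross3 t x) = (t \<bullet> x) *\<^sub>R t - x"
  using Lagrange[of t t x] by simp

text \<open>Every term of the equation is normal to \<open>t\<close>, so applying t x to it loses
  nothing. Since t x annihilates the tangential part of \<open>x\<close>, that part stays free and
  appears on both sides of the solved form.\<close>

lemma cross_equation_iff:
  assumes "t \<bullet> t = 1" "t \<bullet> k = 0" "t \<bullet> y = 0" "a \<noteq> 0"
  shows "(3 * a) *\<^sub>R cross3 t x - p *\<^sub>R k + q *\<^sub>R cross3 c t = y \<longleftrightarrow>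
    x = (t \<bullet> x) *\<^sub>R t
      + (1 / (3 * a)) *\<^sub>R (- cross3 t y - p *\<^sub>R cross3 t k - q *\<^sub>R cross3 t (cross3 t c))"
    (is "?l = y \<longleftrightarrow> x = ?r")
proof
  note cc = cross_cross_unit[OF assms(1)]
  note lin = cross_add_right cross_mult_right Cross3.right_diff_distrib
    cross_skew[of c t]
  {
    assume l: "?l = y"
    have "- cross3 t y - p *\<^sub>R cross3 t k - q *\<^sub>R cross3 t (cross3 t c) = - (3 * a) *\<^sub>R cross3 t (cross3 t x)"
      unfolding l[symmetric] by (simp add: lin)
    also have "\<dots> = (3 * a) *\<^sub>R (x - (t \<bullet> x) *\<^sub>R t)"
      unfolding cc by (simp add: algebra_simps)
    finally show "x = ?r" using assms(4) by simp
  }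
  {
    assume "x = ?r"
    then have "cross3 t x = cross3 t ?r" by (rule arg_cong)
    also have "\<dots> = (1 / (3 * a)) *\<^sub>R (y + p *\<^sub>R k + q *\<^sub>R cross3 t c)"
      using assms(2,3) by (simp add: lin cc dot_cross_self)
    finally show "?l = y"
      using assms(4) by (simp add: lin)
  }
qed

lemma omega_op_eq_iff:
  assumes c: "c \<in> Imm" and y: "\<And>\<theta>. Ds c c \<theta> \<bullet> y \<theta> = 0" and "a \<noteq> 0"
  shows "omega_op a b c X = y \<longleftrightarrow>
    (\<forall>\<theta>. X \<theta> = (Ds c c \<theta> \<bullet> X \<theta>) *\<^sub>R Ds c c \<theta> + (1 / (3 * a)) *\<^sub>R (- (Ds c c \<times>\<^sub>3 y) \<theta>
        - (b * G_id c (c \<times>\<^sub>3 Ds c c) X) *\<^sub>R (Ds c c \<times>\<^sub>3 Ds c (Ds c c)) \<theta>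
        - (b * G_id c (Ds c (Ds c c)) X) *\<^sub>R (Ds c c \<times>\<^sub>3 (Ds c c \<times>\<^sub>3 c)) \<theta>))"
  unfolding omega_op_def fun_eq_iff
  unfolding fcross_def
  by (intro all_cong1 cross_equation_iff Ds_inner_self curvature_orth_tangent c y assms(3))

section \<open>Pairings of candidate solutions with c x T and kappa\<close>

lemma G_id_cong:
  "(\<And>\<theta>. h \<theta> \<bullet> k \<theta> = h' \<theta> \<bullet> k' \<theta>) \<Longrightarrow> G_id c h k = G_id c h' k'"
  by (simp add: G_id_def)

text \<open>For z normal to T, (T x z) . (c x T) = - c . z pointwise; z = y and z = kappa give the
  first two pairings. Likewise T x (T x c) differs from - c by a tangential field, to which kappa is
  normal. Both lengths then come from \<open>G_id_curvature_position\<close>. The zeros hold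
  pointwise; they keep the two scalar unknowns apart.\<close>

lemma G_id_frame:
  assumes c: "c \<in> Imm" and y: "\<And>\<theta>. Ds c c \<theta> \<bullet> y \<theta> = 0"
  shows "G_id c (Ds c c \<times>\<^sub>3 y) (c \<times>\<^sub>3 Ds c c) = - G_id c c y"
    and "G_id c (Ds c c \<times>\<^sub>3 Ds c (Ds c c)) (c \<times>\<^sub>3 Ds c c) = len c"
    and "G_id c (Ds c c \<times>\<^sub>3 (Ds c c \<times>\<^sub>3 c)) (c \<times>\<^sub>3 Ds c c) = 0"
    and "G_id c (Ds c c \<times>\<^sub>3 Ds c (Ds c c)) (Ds c (Ds c c)) = 0"
    and "G_id c (Ds c c \<times>\<^sub>3 (Ds c c \<times>\<^sub>3 c)) (Ds c (Ds c c)) = len c"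
    and "G_id c (\<lambda>\<theta>. f \<theta> *\<^sub>R Ds c c \<theta>) (c \<times>\<^sub>3 Ds c c) = 0"
    and "G_id c (\<lambda>\<theta>. f \<theta> *\<^sub>R Ds c c \<theta>) (Ds c (Ds c c)) = 0"
proof -
  have *: "cross3 t z \<bullet> cross3 p t = - (p \<bullet> z)" if "t \<bullet> t = 1" "t \<bullet> z = 0" for t z p :: "real^3"
    using dot_cross[of t z p t] that by (simp add: inner_commute)
  have 0: "G_id c h k = 0" if "\<And>\<theta>. h \<theta> \<bullet> k \<theta> = 0" for h k
    by (simp add: G_id_def int_ds_def that)
  note T = Ds_inner_self[OF c] and K = curvature_orth_tangent[OF c]
  have yy: "G_id c (Ds c c \<times>\<^sub>3 z) (c \<times>\<^sub>3 Ds c c) = - G_id c c z"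
    if "\<And>\<theta>. Ds c c \<theta> \<bullet> z \<theta> = 0" for z
    unfolding G_id_minus[symmetric]
    by (rule G_id_cong) (simp add: fcross_def * T that)
  show "G_id c (Ds c c \<times>\<^sub>3 y) (c \<times>\<^sub>3 Ds c c) = - G_id c c y"
    by (rule yy[OF y])
  show "G_id c (Ds c c \<times>\<^sub>3 Ds c (Ds c c)) (c \<times>\<^sub>3 Ds c c) = len c"
    using yy[OF K] G_id_curvature_position[OF c] by (simp add: G_id_commute)
  show "G_id c (Ds c c \<times>\<^sub>3 (Ds c c \<times>\<^sub>3 c)) (c \<times>\<^sub>3 Ds c c) = 0"
    by (rule 0) (simp add: fcross_def cross_skew[of "c _"] dot_cross_self)
  show "G_id c (Ds c c \<times>\<^sub>3 Ds c (Ds c c)) (Ds c (Ds c c)) = 0"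
    by (rule 0) (simp add: fcross_def dot_cross_self)
  have "G_id c (Ds c c \<times>\<^sub>3 (Ds c c \<times>\<^sub>3 c)) (Ds c (Ds c c)) = G_id c (\<lambda>\<theta>. - c \<theta>) (Ds c (Ds c c))"
    by (rule G_id_cong) (simp add: fcross_def cross_cross_unit[OF T] inner_diff_left K)
  then show "G_id c (Ds c c \<times>\<^sub>3 (Ds c c \<times>\<^sub>3 c)) (Ds c (Ds c c)) = len c"
    using G_id_curvature_position[OF c] by (simp add: G_id_minus G_id_commute)
  show "G_id c (\<lambda>\<theta>. f \<theta> *\<^sub>R Ds c c \<theta>) (c \<times>\<^sub>3 Ds c c) = 0"
    by (rule 0) (simp add: fcross_def dot_cross_self)
  show "G_id c (\<lambda>\<theta>. f \<theta> *\<^sub>R Ds c c \<theta>) (Ds c (Ds c c)) = 0"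
    by (rule 0) (simp add: K)
qed

text \<open>Here \<open>p\<close> and \<open>q\<close> are arbitrary numbers. In the nondegenerate
  case they are multiples of the pairings of X itself, which makes the last two identities equations
  for those pairings; in the degenerate case both are 0.\<close>

lemma G_id_solution:
  assumes c: "c \<in> Imm" and y: "y \<in> Csm" "\<And>\<theta>. Ds c c \<theta> \<bullet> y \<theta> = 0"
    and X: "X = (\<lambda>\<theta>. r *\<^sub>R (- (Ds c c \<times>\<^sub>3 y) \<theta> - p *\<^sub>R (Ds c c \<times>\<^sub>3 Ds c (Ds c c)) \<theta>
        - q *\<^sub>R (Ds c c \<times>\<^sub>3 (Ds c c \<times>\<^sub>3 c)) \<theta>))"
  shows "X \<in> Csm" "\<And>\<theta>. Ds c c \<theta> \<bullet> X \<theta> = 0"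
    and "G_id c (c \<times>\<^sub>3 Ds c c) X = r * (G_id c c y - p * len c)"
    and "G_id c (Ds c (Ds c c)) X = r * (- G_id c (Ds c (Ds c c)) (Ds c c \<times>\<^sub>3 y) - q * len c)"
proof -
  note C = Csm_frame[OF c] Csm_fcross[OF Csm_frame(1)[OF c] y(1)] and F = G_id_frame[OF c y(2)]
  show "X \<in> Csm" unfolding X by (intro Csm_intros C)
  show "Ds c c \<theta> \<bullet> X \<theta> = 0" for \<theta>
    by (simp add: X fcross_def inner_diff_right dot_cross_self)
  show "G_id c (c \<times>\<^sub>3 Ds c c) X = r * (G_id c c y - p * len c)"
    unfolding G_id_commute[of c _ X] unfolding X using C c
    by (simp add: G_id_linear_left Csm_intros F)
  show "G_id c (Ds c (Ds c c)) X = r * (- G_id c (Ds c (Ds c c)) (Ds c c \<times>\<^sub>3 y) - q * len c)"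
    unfolding G_id_commute[of c "Ds c (Ds c c)"] unfolding X using C c
    by (simp add: G_id_linear_left Csm_intros F)
qed

lemma hgrad_formula_unique:
  assumes c: "c \<in> Imm" and y: "y \<in> Csm" "\<And>\<theta>. Ds c c \<theta> \<bullet> y \<theta> = 0"
    and a: "\<Phi> (len c) \<noteq> 0" "3 * \<Phi> (len c) + deriv \<Phi> (len c) * len c \<noteq> 0"
  shows "X \<in> Csm \<and> omega_op (\<Phi> (len c)) (deriv \<Phi> (len c)) c X = y \<and> (\<forall>\<theta>. X \<theta> \<bullet> Ds c c \<theta> = 0)
    \<longleftrightarrow> X = hgrad_formula \<Phi> c y"
proof -
  define a b where "a = \<Phi> (len c)" and "b = deriv \<Phi> (len c)"
  define d where "d = 3 * a + b * len c"
  define A where "A = G_id c c y"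
  define B where "B = G_id c (Ds c (Ds c c)) (Ds c c \<times>\<^sub>3 y)"
  define sol where "sol p q = (\<lambda>\<theta>. (1 / (3 * a)) *\<^sub>R (- (Ds c c \<times>\<^sub>3 y) \<theta>
      - p *\<^sub>R (Ds c c \<times>\<^sub>3 Ds c (Ds c c)) \<theta> - q *\<^sub>R (Ds c c \<times>\<^sub>3 (Ds c c \<times>\<^sub>3 c)) \<theta>))" for p q
  note S = G_id_solution[OF c y sol_def, folded A_def B_def]
  have nz: "a \<noteq> 0" "d \<noteq> 0" using a by (auto simp: a_def b_def d_def)
  \<comment> \<open>The values come from u = G(c x T, X) and v = G(kappa, X): the equations 3 a u =
    A - b u len and 3 a v = - B - b v len give u = A / d and v = - B / d. The signs of the two
    bracketed terms of the formula are those of - b u and - b v.\<close>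
  have form: "hgrad_formula \<Phi> c y = sol (b * (A / d)) (b * (- B / d))"
    unfolding hgrad_formula_def sol_def a_def[symmetric] b_def[symmetric] d_def[symmetric]
      A_def[symmetric] B_def[symmetric]
    by (simp add: algebra_simps)
  \<comment> \<open>The left side is implicit in X. One direction solves for the two pairings; the
    other verifies that the explicit field indeed has the pairings put into it.\<close>
  have sol1: "X = sol (b * G_id c (c \<times>\<^sub>3 Ds c c) X) (b * G_id c (Ds c (Ds c c)) X) \<longleftrightarrow>
    X = sol (b * (A / d)) (b * (- B / d))" for X
  proof
    assume X: "X = sol (b * G_id c (c \<times>\<^sub>3 Ds c c) X) (b * G_id c (Ds c (Ds c c)) X)"
    define u v where "u = G_id c (c \<times>\<^sub>3 Ds c c) X" and "v = G_id c (Ds c (Ds c c)) X"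
    have "u = 1 / (3 * a) * (A - b * u * len c)" "v = 1 / (3 * a) * (- B - b * v * len c)"
      using S(3,4)[of "b * u" "b * v"] X unfolding u_def v_def by simp_all
    then have "u * d = A" "v * d = - B"
      using nz(1) by (simp_all add: d_def field_simps)
    then have "u = A / d" "v = - B / d" using nz(2) by (simp_all add: field_simps)
    then show "X = sol (b * (A / d)) (b * (- B / d))"
      using X by (simp add: u_def v_def)
  next
    assume X: "X = sol (b * (A / d)) (b * (- B / d))"
    have "A - b * (A / d) * len c = 3 * a * (A / d)" "- B - b * (- B / d) * len c = 3 * a * (- B / d)"
      using nz(2) by (simp_all add: d_def field_simps)
    then have "G_id c (c \<times>\<^sub>3 Ds c c) X = A / d" "G_id c (Ds c (Ds c c)) X = - B / d"
      unfolding X S(3,4) using nz(1) by simp_all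
    then show "X = sol (b * G_id c (c \<times>\<^sub>3 Ds c c) X) (b * G_id c (Ds c (Ds c c)) X)"
      using X by simp
  qed
  have op: "omega_op a b c X = y \<longleftrightarrow>
      (\<forall>\<theta>. X \<theta> = (Ds c c \<theta> \<bullet> X \<theta>) *\<^sub>R Ds c c \<theta>
        + sol (b * G_id c (c \<times>\<^sub>3 Ds c c) X) (b * G_id c (Ds c (Ds c c)) X) \<theta>)"
    using omega_op_eq_iff[OF c y(2) nz(1)] by (simp add: sol_def)
  show ?thesis
    unfolding form a_def[symmetric] b_def[symmetric] op
  proof
    assume "X = sol (b * (A / d)) (b * (- B / d))"
    then show "X \<in> Csm \<and> (\<forall>\<theta>. X \<theta> = (Ds c c \<theta> \<bullet> X \<theta>) *\<^sub>R Ds c c \<theta>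
        + sol (b * G_id c (c \<times>\<^sub>3 Ds c c) X) (b * G_id c (Ds c (Ds c c)) X) \<theta>)
        \<and> (\<forall>\<theta>. X \<theta> \<bullet> Ds c c \<theta> = 0)"
      using S(1,2) sol1[of X] by (metis add_0 inner_commute scaleR_zero_left)
  qed (subst sol1[symmetric], auto simp: fun_eq_iff inner_commute)
qed

lemma binormal_unique:
  assumes c: "c \<in> Imm"
  shows "is_hgrad Omega_MW len c X \<longleftrightarrow> X = binormal_field c"
proof -
  let ?\<kappa> = "Ds c (Ds c c)"
  have ham: "is_ham Omega_MW len c X \<longleftrightarrow> X \<in> Csm \<and> Ds c c \<times>\<^sub>3 X = (\<lambda>\<theta>. - ?\<kappa> \<theta>)"
    by (rule is_ham_iff[OF c])
      (use c in \<open>simp_all add: Csm_minus Csm_frame Csm_fcross differential_len G_id_minus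
        Omega_MW_def Omega_id_eq\<close>)
  have "Ds c c \<times>\<^sub>3 X = (\<lambda>\<theta>. - ?\<kappa> \<theta>) \<longleftrightarrow>
    (\<forall>\<theta>. X \<theta> = (Ds c c \<theta> \<bullet> X \<theta>) *\<^sub>R Ds c c \<theta> + binormal_field c \<theta>)"
    \<comment> \<open>With \<open>a = 1/3\<close> the coefficient 3 a is 1, the normalization of the
      Marsden-Weinstein form; no multiple of kappa or c x T occurs, so \<open>p\<close> and
      \<open>q\<close> are 0.\<close>
    using cross_equation_iff[OF Ds_inner_self[OF c] curvature_orth_tangent[OF c], where a = "1/3" and p = 0 and q = 0]
      curvature_orth_tangent[OF c]
    by (simp add: fun_eq_iff fcross_def binormal_field_def)
  moreover have "binormal_field c \<in> Csm" "Ds c c \<theta> \<bullet> binormal_field c \<theta> = 0" for \<theta>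
    using Csm_frame(4)[OF c] by (simp_all add: binormal_field_def fcross_def dot_cross_self)
  ultimately show ?thesis
    unfolding is_hgrad_def ham by (auto simp: inner_commute)
qed

subsection \<open>The degenerate case\<close>

definition kernel_span :: "scurve \<Rightarrow> scurve set" where
  "kernel_span c = {\<lambda>\<theta>. \<alpha> *\<^sub>R scaling_field c \<theta> + \<beta> *\<^sub>R binormal_field c \<theta> + a \<theta> *\<^sub>R Ds c c \<theta>
    | \<alpha> \<beta> a. a \<in> Csm}"

text \<open>T x (T x c) is minus the normal part of c, so exchanging it for c only shifts the
  tangential coefficient by the smooth function \<alpha> (T . c). The normal generator is the one
  that \<open>G_id_frame\<close> can pair.\<close>

lemma kernel_span_perp:
  assumes c: "c \<in> Imm" and f: "f \<in> Csm"
  shows "(\<lambda>\<theta>. \<alpha> *\<^sub>R (Ds c c \<times>\<^sub>3 (Ds c c \<times>\<^sub>3 c)) \<theta> + \<beta> *\<^sub>R binormal_field c \<theta> + f \<theta> *\<^sub>R Ds c c \<theta>)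
    \<in> kernel_span c"
  unfolding kernel_span_def mem_Collect_eq
proof (intro exI conjI)
  let ?f = "\<lambda>\<theta>. f \<theta> + \<alpha> * (Ds c c \<theta> \<bullet> c \<theta>)"
  show "?f \<in> Csm" by (intro Csm_intros f Csm_frame c Imm_Csm)
  show "(\<lambda>\<theta>. \<alpha> *\<^sub>R (Ds c c \<times>\<^sub>3 (Ds c c \<times>\<^sub>3 c)) \<theta> + \<beta> *\<^sub>R binormal_field c \<theta> + f \<theta> *\<^sub>R Ds c c \<theta>)
    = (\<lambda>\<theta>. (- \<alpha>) *\<^sub>R scaling_field c \<theta> + \<beta> *\<^sub>R binormal_field c \<theta> + ?f \<theta> *\<^sub>R Ds c c \<theta>)"
    by (simp add: fun_eq_iff fcross_def cross_cross_unit[OF Ds_inner_self[OF c]] scaling_field_def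
        algebra_simps)
qed

lemma kernel_span_perpE:
  assumes c: "c \<in> Imm" and "h \<in> kernel_span c"
  obtains \<alpha> \<beta> f where "f \<in> Csm"
    "h = (\<lambda>\<theta>. \<alpha> *\<^sub>R (Ds c c \<times>\<^sub>3 (Ds c c \<times>\<^sub>3 c)) \<theta> + \<beta> *\<^sub>R binormal_field c \<theta> + f \<theta> *\<^sub>R Ds c c \<theta>)"
proof -
  obtain \<alpha> \<beta> f where f: "f \<in> Csm"
    and h: "h = (\<lambda>\<theta>. \<alpha> *\<^sub>R scaling_field c \<theta> + \<beta> *\<^sub>R binormal_field c \<theta> + f \<theta> *\<^sub>R Ds c c \<theta>)"
    using assms(2) unfolding kernel_span_def by blast
  show thesis
  proof (rule that)
    let ?f = "\<lambda>\<theta>. f \<theta> + \<alpha> * (Ds c c \<theta> \<bullet> c \<theta>)"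
    show "?f \<in> Csm" by (intro Csm_intros f Csm_frame c Imm_Csm)
    show "h = (\<lambda>\<theta>. (- \<alpha>) *\<^sub>R (Ds c c \<times>\<^sub>3 (Ds c c \<times>\<^sub>3 c)) \<theta> + \<beta> *\<^sub>R binormal_field c \<theta> + ?f \<theta> *\<^sub>R Ds c c \<theta>)"
      unfolding h
      by (simp add: fun_eq_iff fcross_def cross_cross_unit[OF Ds_inner_self[OF c]] scaling_field_def
          algebra_simps)
  qed
qed

text \<open>Solving with right-hand side 0 always gives a combination of T x (T x c), the binormal
  field and a tangential field. The relation \<open>deg\<close> makes every such combination
  consistent with its own two pairings.\<close>

lemma omega_op_kernel:
  assumes c: "c \<in> Imm" and "a \<noteq> 0" and deg: "b * len c = - 3 * a"
  shows "h \<in> Csm \<and> omega_op a b c h = (\<lambda>\<theta>. 0) \<longleftrightarrow> h \<in> kernel_span c"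
proof
  let ?p = "b * G_id c (c \<times>\<^sub>3 Ds c c) h" and ?q = "b * G_id c (Ds c (Ds c c)) h"
  assume h: "h \<in> Csm \<and> omega_op a b c h = (\<lambda>\<theta>. 0)"
  then have eq: "\<forall>\<theta>. h \<theta> = (Ds c c \<theta> \<bullet> h \<theta>) *\<^sub>R Ds c c \<theta>
      + (1 / (3 * a)) *\<^sub>R (- (Ds c c \<times>\<^sub>3 (\<lambda>\<theta>. 0)) \<theta>
        - ?p *\<^sub>R (Ds c c \<times>\<^sub>3 Ds c (Ds c c)) \<theta> - ?q *\<^sub>R (Ds c c \<times>\<^sub>3 (Ds c c \<times>\<^sub>3 c)) \<theta>)"
    using omega_op_eq_iff[OF c, of "\<lambda>\<theta>. 0" a b h] assms(2) by simp
  have eq': "h = (\<lambda>\<theta>. (- ?q / (3 * a)) *\<^sub>R (Ds c c \<times>\<^sub>3 (Ds c c \<times>\<^sub>3 c)) \<theta>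
      + (- ?p / (3 * a)) *\<^sub>R binormal_field c \<theta> + (Ds c c \<theta> \<bullet> h \<theta>) *\<^sub>R Ds c c \<theta>)"
    by (rule ext, rule trans[OF spec[OF eq]])
      (simp add: fcross_def binormal_field_def scaleR_diff_right)
  have "(\<lambda>\<theta>. Ds c c \<theta> \<bullet> h \<theta>) \<in> Csm" using h by (intro Csm_inner Csm_frame c) auto
  then show "h \<in> kernel_span c" by (subst eq') (rule kernel_span_perp[OF c])
next
  assume "h \<in> kernel_span c"
  then obtain \<alpha> \<beta> f where f: "f \<in> Csm"
    and h: "h = (\<lambda>\<theta>. \<alpha> *\<^sub>R (Ds c c \<times>\<^sub>3 (Ds c c \<times>\<^sub>3 c)) \<theta> + \<beta> *\<^sub>R binormal_field c \<theta> + f \<theta> *\<^sub>R Ds c c \<theta>)"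
    by (rule kernel_span_perpE[OF c])
  note C = Csm_frame[OF c]
  have hC: "h \<in> Csm" unfolding h binormal_field_def by (intro Csm_intros C f)
  have "G_id c h (c \<times>\<^sub>3 Ds c c) = \<beta> * len c" "G_id c h (Ds c (Ds c c)) = \<alpha> * len c"
    unfolding h binormal_field_def using C c f G_id_frame[OF c, of "\<lambda>\<theta>. 0"]
    by (simp_all add: G_id_linear_left Csm_intros)
  \<comment> \<open>Through \<open>deg\<close>, the length in each pairing turns into the factor - 3
    a, which the prefactor 1 / (3 a) and the minus signs of the solved equation undo; \<alpha> and
    \<beta> are returned unchanged.\<close>
  then have G: "b * G_id c (c \<times>\<^sub>3 Ds c c) h = - 3 * a * \<beta>" "b * G_id c (Ds c (Ds c c)) h = - 3 * a * \<alpha>"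
    using deg by (simp_all add: G_id_commute[of c _ h] mult.left_commute)
  have Th: "Ds c c \<theta> \<bullet> h \<theta> = f \<theta>" for \<theta>
    by (simp add: h binormal_field_def fcross_def inner_add_right dot_cross_self Ds_inner_self[OF c])
  have "omega_op a b c h = (\<lambda>\<theta>. 0)"
    unfolding omega_op_eq_iff[OF c inner_zero_right assms(2)] G Th
    using assms(2) by (simp add: h binormal_field_def fcross_def scaleR_add_right)
  with hC show "h \<in> Csm \<and> omega_op a b c h = (\<lambda>\<theta>. 0)" by simp
qed

lemma omega_op_diff:
  assumes c: "c \<in> Imm" and h: "h \<in> Csm" and k: "k \<in> Csm"
  shows "omega_op a b c (\<lambda>\<theta>. h \<theta> - k \<theta>) \<theta> = omega_op a b c h \<theta> - omega_op a b c k \<theta>"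
proof -
  have "G_id c z (\<lambda>\<theta>. h \<theta> - k \<theta>) = G_id c z h - G_id c z k" if "z \<in> Csm" for z
    using G_id_diff[OF c h k that] by (simp add: G_id_commute[of c z])
  from this[OF Csm_frame(2)[OF c]] this[OF Csm_frame(3)[OF c]] show ?thesis
    by (simp only: omega_op_def) (simp add: fcross_def Cross3.right_diff_distrib algebra_simps)
qed

section \<open>Orthogonal projection off the kernel\<close>

lemma G_id_project:
  assumes c: "c \<in> Imm" and x: "x \<in> Csm" and e: "e \<in> Csm"
  obtains \<alpha> where "G_id c (\<lambda>\<theta>. x \<theta> - \<alpha> *\<^sub>R e \<theta>) e = 0"
proof (cases "G_id c e e = 0")
  \<comment> \<open>A field of norm zero is zero and any coefficient serves. Treating this case
    avoids proving linear independence of the directions that are projected off.\<close>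
  case True
  then have "e = (\<lambda>\<theta>. 0)" using G_id_definite[OF c e] by simp
  then have "G_id c (\<lambda>\<theta>. x \<theta> - 0 *\<^sub>R e \<theta>) e = 0" by (simp add: G_id_def int_ds_def)
  then show ?thesis by (rule that)
next
  case False
  have "G_id c (\<lambda>\<theta>. x \<theta> - (G_id c x e / G_id c e e) *\<^sub>R e \<theta>) e = 0"
    using False c x e by (simp add: G_id_linear_left Csm_intros)
  then show ?thesis by (rule that)
qed

text \<open>Gram-Schmidt: after \<open>e\<close>, project off the part of \<open>e'\<close>
  orthogonal to \<open>e\<close>, then rewrite the result in terms of \<open>e\<close> and
  \<open>e'\<close>.\<close>

lemma G_id_project2:
  assumes c: "c \<in> Imm" and x: "x \<in> Csm" and e: "e \<in> Csm" and e': "e' \<in> Csm"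
  obtains \<alpha> \<beta> where "G_id c (\<lambda>\<theta>. x \<theta> - (\<alpha> *\<^sub>R e \<theta> + \<beta> *\<^sub>R e' \<theta>)) e = 0"
    "G_id c (\<lambda>\<theta>. x \<theta> - (\<alpha> *\<^sub>R e \<theta> + \<beta> *\<^sub>R e' \<theta>)) e' = 0"
proof -
  obtain \<alpha> where \<alpha>: "G_id c (\<lambda>\<theta>. x \<theta> - \<alpha> *\<^sub>R e \<theta>) e = 0" by (rule G_id_project[OF c x e])
  obtain \<gamma> where \<gamma>: "G_id c (\<lambda>\<theta>. e' \<theta> - \<gamma> *\<^sub>R e \<theta>) e = 0" by (rule G_id_project[OF c e' e])
  obtain \<beta> where \<beta>: "G_id c (\<lambda>\<theta>. (x \<theta> - \<alpha> *\<^sub>R e \<theta>) - \<beta> *\<^sub>R (e' \<theta> - \<gamma> *\<^sub>R e \<theta>)) (\<lambda>\<theta>. e' \<theta> - \<gamma> *\<^sub>R e \<theta>) = 0"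
    by (rule G_id_project[OF c, of "\<lambda>\<theta>. x \<theta> - \<alpha> *\<^sub>R e \<theta>" "\<lambda>\<theta>. e' \<theta> - \<gamma> *\<^sub>R e \<theta>"])
      (intro Csm_intros x e e')+
  let ?P = "\<lambda>\<theta>. (x \<theta> - \<alpha> *\<^sub>R e \<theta>) - \<beta> *\<^sub>R (e' \<theta> - \<gamma> *\<^sub>R e \<theta>)"
  have P: "?P = (\<lambda>\<theta>. x \<theta> - ((\<alpha> - \<beta> * \<gamma>) *\<^sub>R e \<theta> + \<beta> *\<^sub>R e' \<theta>))"
    by (simp add: fun_eq_iff algebra_simps)
  have "?P \<in> Csm" by (intro Csm_intros x e e')
  have Pe: "G_id c ?P e = 0"
    using \<alpha> \<gamma> c x e e' by (simp add: G_id_linear_left Csm_intros algebra_simps)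
  have "G_id c ?P e' = G_id c ?P (\<lambda>\<theta>. e' \<theta> - \<gamma> *\<^sub>R e \<theta>) + \<gamma> * G_id c ?P e"
    unfolding G_id_commute[of c ?P] using c e e' \<open>?P \<in> Csm\<close> by (simp add: G_id_linear_left Csm_intros)
  with \<beta> Pe have "G_id c ?P e' = 0" by simp
  with Pe show ?thesis unfolding P by (rule that)
qed

text \<open>The field \<open>X0\<close> solves the Hamilton equation and is already normal to T, so
  it is enough to project off two normal fields; this subtracts a kernel element and keeps the
  equation.\<close>

lemma projection_onto_kernel_complement:
  assumes c: "c \<in> Imm" and y: "y \<in> Csm" "\<And>\<theta>. Ds c c \<theta> \<bullet> y \<theta> = 0"
    and a: "a \<noteq> 0" and deg: "b * len c = - 3 * a"
    and inv: "G_id c y (scaling_field c) = 0" "G_id c y (binormal_field c) = 0"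
    and r: "r = 1 / (3 * a)"
  obtains P where
    "is_orth_proj c (orth_compl c (kernel_span c)) (\<lambda>\<theta>. (- r) *\<^sub>R (Ds c c \<times>\<^sub>3 y) \<theta>) P"
    "\<And>X. X \<in> Csm \<and> omega_op a b c X = y \<and> X \<in> orth_compl c (kernel_span c) \<longleftrightarrow> X = P"
proof -
  let ?e = "Ds c c \<times>\<^sub>3 (Ds c c \<times>\<^sub>3 c)" and ?B = "binormal_field c"
  define X0 where "X0 = (\<lambda>\<theta>. (- r) *\<^sub>R (Ds c c \<times>\<^sub>3 y) \<theta>)"
  note C = Csm_frame[OF c] and T = Ds_inner_self[OF c]
  have B: "?B \<in> Csm" unfolding binormal_field_def by (rule C)
  have X0_eq: "X0 = (\<lambda>\<theta>. r *\<^sub>R (- (Ds c c \<times>\<^sub>3 y) \<theta> - 0 *\<^sub>R (Ds c c \<times>\<^sub>3 Ds c (Ds c c)) \<theta> - 0 *\<^sub>R ?e \<theta>))"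
    by (simp add: X0_def)
  note S = G_id_solution[OF c y X0_eq]
  \<comment> \<open>Cyclic symmetry of the triple product moves T x from y to kappa, so the pairing
    becomes one of y with the binormal field and vanishes by invariance.\<close>
  have "G_id c (Ds c (Ds c c)) (Ds c c \<times>\<^sub>3 y) = G_id c (\<lambda>\<theta>. - y \<theta>) ?B"
    by (rule G_id_cong) (simp add: binormal_field_def fcross_def cross3_simps)
  then have \<kappa>y: "G_id c (Ds c (Ds c c)) (Ds c c \<times>\<^sub>3 y) = 0"
    using inv(2) by (simp add: G_id_minus)
  \<comment> \<open>These two numbers are the coefficients through which a solution depends on
    itself. Both being 0, \<open>X0\<close> satisfies the solved equation.\<close>
  have G0: "G_id c (c \<times>\<^sub>3 Ds c c) X0 = 0" "G_id c (Ds c (Ds c c)) X0 = 0"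
    using S(3,4) \<kappa>y inv(1) by (simp_all add: G_id_commute[of c c] scaling_field_def)
  have X0_ham: "omega_op a b c X0 = y"
    unfolding omega_op_eq_iff[OF c y(2) a] G0 S(2) by (simp add: X0_def r)
  obtain \<alpha> \<beta> where P0: "G_id c (\<lambda>\<theta>. X0 \<theta> - (\<alpha> *\<^sub>R ?e \<theta> + \<beta> *\<^sub>R ?B \<theta>)) ?e = 0"
    "G_id c (\<lambda>\<theta>. X0 \<theta> - (\<alpha> *\<^sub>R ?e \<theta> + \<beta> *\<^sub>R ?B \<theta>)) ?B = 0"
    by (rule G_id_project2[OF c S(1) C(5) B])
  define P where "P = (\<lambda>\<theta>. X0 \<theta> - (\<alpha> *\<^sub>R ?e \<theta> + \<beta> *\<^sub>R ?B \<theta>))"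
  have P: "P \<in> Csm" unfolding P_def by (intro Csm_intros S(1) C B)
  have TP: "Ds c c \<theta> \<bullet> P \<theta> = 0" for \<theta>
    unfolding P_def inner_diff_right inner_add_right S(2)
    by (simp add: binormal_field_def fcross_def dot_cross_self)
  have PW: "P \<in> orth_compl c (kernel_span c)"
    unfolding orth_compl_def mem_Collect_eq
  proof (intro conjI ballI P)
    fix k assume "k \<in> kernel_span c"
    then obtain \<alpha>' \<beta>' f where f: "f \<in> Csm"
      and k: "k = (\<lambda>\<theta>. \<alpha>' *\<^sub>R ?e \<theta> + \<beta>' *\<^sub>R ?B \<theta> + f \<theta> *\<^sub>R Ds c c \<theta>)"
      by (rule kernel_span_perpE[OF c])
    have "G_id c (\<lambda>\<theta>. f \<theta> *\<^sub>R Ds c c \<theta>) P = 0"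
      by (simp add: G_id_def int_ds_def TP)
    then have "G_id c k P = 0"
      unfolding k using c C B P f P0[folded P_def]
      by (simp add: G_id_linear_left Csm_intros G_id_commute[of c P])
    then show "G_id c P k = 0" by (simp add: G_id_commute)
  qed
  have X0P: "(\<lambda>\<theta>. X0 \<theta> - P \<theta>) \<in> kernel_span c"
    using kernel_span_perp[OF c Csm_const[of 0], of \<alpha> \<beta>] by (simp add: P_def)
  note ker = omega_op_kernel[OF c a deg]
  have P_ham: "omega_op a b c P = y"
  proof
    fix \<theta>
    have "omega_op a b c (\<lambda>\<theta>. X0 \<theta> - P \<theta>) = (\<lambda>\<theta>. 0)"
      using ker[THEN iffD2, OF X0P] by blast
    from fun_cong[OF this, of \<theta>] have "omega_op a b c X0 \<theta> - omega_op a b c P \<theta> = 0"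
      unfolding omega_op_diff[OF c S(1) P] .
    then show "omega_op a b c P \<theta> = y \<theta>" by (simp add: X0_ham)
  qed
  \<comment> \<open>The difference of two solutions in the complement lies in the kernel as well, so
    it is orthogonal to itself.\<close>
  have uniq: "X = P" if X: "X \<in> Csm" "omega_op a b c X = y" "X \<in> orth_compl c (kernel_span c)" for X
  proof -
    let ?D = "\<lambda>\<theta>. X \<theta> - P \<theta>"
    have D: "?D \<in> Csm" by (intro Csm_diff X(1) P)
    moreover have "omega_op a b c ?D = (\<lambda>\<theta>. 0)"
      using omega_op_diff[OF c X(1) P, of a b] X(2) P_ham by (simp add: fun_eq_iff)
    ultimately have "?D \<in> kernel_span c" by (intro ker[THEN iffD1] conjI)
    then have "G_id c X ?D = 0" "G_id c P ?D = 0"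
      using X(3) PW unfolding orth_compl_def by blast+
    then have "G_id c ?D ?D = 0" using G_id_diff[OF c X(1) P D] by simp
    then show ?thesis using G_id_definite[OF c D] by (simp add: fun_eq_iff)
  qed
  show ?thesis
  proof (rule that)
    show "is_orth_proj c (orth_compl c (kernel_span c)) (\<lambda>\<theta>. (- r) *\<^sub>R (Ds c c \<times>\<^sub>3 y) \<theta>) P"
      unfolding is_orth_proj_def fun_cong[OF X0_def, symmetric]
    proof (intro conjI PW ballI)
      fix w assume "w \<in> orth_compl c (kernel_span c)"
      then have "G_id c w (\<lambda>\<theta>. X0 \<theta> - P \<theta>) = 0" using X0P unfolding orth_compl_def by blast
      then show "G_id c (\<lambda>\<theta>. X0 \<theta> - P \<theta>) w = 0" by (simp add: G_id_commute)
    qed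
    show "X \<in> Csm \<and> omega_op a b c X = y \<and> X \<in> orth_compl c (kernel_span c) \<longleftrightarrow> X = P" for X
      using uniq P P_ham PW by blast
  qed
qed

text \<open>3 Phi + Phi' l is l^-2 times the derivative of l^3 Phi. It vanishes identically exactly
  when Phi = C / l^3, but for another Phi it may still vanish at particular lengths; the formula of
  the first part is asserted at the curves where it can be divided by.\<close>

theorem corollary4p2:
  fixes \<Phi> :: "real \<Rightarrow> real"
    and H :: "scurve \<Rightarrow> real"
    and g :: "scurve \<Rightarrow> scurve"
  assumes "smooth_on {0<..} \<Phi>"
    and "\<forall>x>0. \<Phi> x > 0"
    and "DiffP_invariant H"
    and "is_grad_id H g"
  shows
    "((\<nexists>C. \<forall>x>0. \<Phi> x = C / x ^ 3) \<longrightarrow>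
       (\<forall>c\<in>Imm. 3 * \<Phi> (len c) + deriv \<Phi> (len c) * len c \<noteq> 0 \<longrightarrow>
         (\<forall>X. is_hgrad (Omega_Phi \<Phi>) H c X \<longleftrightarrow> X = hgrad_formula \<Phi> c (g c))))
     \<and>
     (\<forall>C. (\<forall>x>0. \<Phi> x = C / x ^ 3)
         \<and> flow_invariant scaling_field H \<and> flow_invariant binormal_field H \<longrightarrow>
       (\<forall>c\<in>Imm.
         (\<forall>X. is_hgrad Omega_MW len c X \<longleftrightarrow> X = binormal_field c)
         \<and> ker_form (Omega_Phi \<Phi>) c =
             {\<lambda>\<theta>. \<alpha> *\<^sub>R scaling_field c \<theta> + \<beta> *\<^sub>R binormal_field c \<theta> + a \<theta> *\<^sub>R Ds c c \<theta>
                | \<alpha> \<beta> a. a \<in> Csm}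
         \<and> (\<exists>P. is_orth_proj c (orth_compl c (ker_form (Omega_Phi \<Phi>) c))
                  (\<lambda>\<theta>. - (len c ^ 3 / (3 * C)) *\<^sub>R (Ds c c \<times>\<^sub>3 g c) \<theta>) P
               \<and> (\<forall>X. is_hgrad_ker (Omega_Phi \<Phi>) H c X \<longleftrightarrow> X = P))))"
proof -
  have \<Phi>': "(\<Phi> has_real_derivative deriv \<Phi> (len c)) (at (len c))" if "c \<in> Imm" for c
    using smooth_on_has_derivative[OF assms(1), of "len c"] len_pos[OF that]
    unfolding DERIV_deriv_iff_real_differentiable by (auto simp: differentiable_def)
  have g: "g c \<in> Csm" "\<And>\<theta>. Ds c c \<theta> \<bullet> g c \<theta> = 0" if "c \<in> Imm" for c
    using assms(4) that grad_orth_tangent[OF assms(4,3) that] by (auto simp: is_grad_id_def)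
  have ham: "is_ham (Omega_Phi \<Phi>) H c X \<longleftrightarrow>
      X \<in> Csm \<and> omega_op (\<Phi> (len c)) (deriv \<Phi> (len c)) c X = g c" if c: "c \<in> Imm" for c X
    by (rule is_ham_iff[where \<Omega> = "Omega_Phi \<Phi>" and A = "omega_op (\<Phi> (len c)) (deriv \<Phi> (len c)) c",
          OF c g(1)[OF c] _ Omega_Phi_eq_G_id[OF c _ _ \<Phi>'[OF c]] Csm_omega_op[OF c]])
      (use assms(4) c in \<open>auto simp: is_grad_id_def\<close>)
  have a: "is_hgrad (Omega_Phi \<Phi>) H c X \<longleftrightarrow> X = hgrad_formula \<Phi> c (g c)"
    if c: "c \<in> Imm" and "3 * \<Phi> (len c) + deriv \<Phi> (len c) * len c \<noteq> 0" for c X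
    using hgrad_formula_unique[OF c g[OF c] _ that(2), of X] assms(2) len_pos[OF c]
    by (simp add: is_hgrad_def ham[OF c] less_imp_neq[THEN not_sym])
  have b: "ker_form (Omega_Phi \<Phi>) c = kernel_span c \<and>
      (\<exists>P. is_orth_proj c (orth_compl c (kernel_span c))
          (\<lambda>\<theta>. (- (len c ^ 3 / (3 * C))) *\<^sub>R (Ds c c \<times>\<^sub>3 g c) \<theta>) P
        \<and> (\<forall>X. is_hgrad_ker (Omega_Phi \<Phi>) H c X \<longleftrightarrow> X = P))"
    if C: "\<And>x. x > 0 \<Longrightarrow> \<Phi> x = C / x ^ 3" and I: "flow_invariant scaling_field H"
      and B: "flow_invariant binormal_field H" and c: "c \<in> Imm" for C c
  proof -
    let ?l = "len c"
    have l: "?l > 0" by (rule len_pos[OF c])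
    have nz: "\<Phi> ?l \<noteq> 0" "C \<noteq> 0" using assms(2) l C[OF l] by force+
    have "((\<lambda>x. C / x ^ 3) has_real_derivative - 3 * C / ?l ^ 4) (at ?l)"
      using l by (auto intro!: derivative_eq_intros simp: field_simps power_numeral_reduce)
    \<comment> \<open>Phi is known to be C / x^3 for positive x only, so the derivative is
      transferred within that open half-line.\<close>
    then have "(\<Phi> has_real_derivative - 3 * C / ?l ^ 4) (at ?l)"
      by (rule has_field_derivative_transform_within_open[where S = "{0<..}"])
        (use l C in auto)
    then have "deriv \<Phi> ?l = - 3 * C / ?l ^ 4" by (rule DERIV_imp_deriv)
    then have deg: "deriv \<Phi> ?l * ?l = - 3 * \<Phi> ?l"
      using l unfolding C[OF l] by (simp add: field_simps power_numeral_reduce)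
    \<comment> \<open>This identifies the constant of the statement with the prefactor 1 / (3 Phi)
      of the solved Hamilton equation.\<close>
    have r: "?l ^ 3 / (3 * C) = 1 / (3 * \<Phi> ?l)" using C[OF l] by simp
    have inv: "G_id c (g c) (scaling_field c) = 0" "G_id c (g c) (binormal_field c) = 0"
      by (rule grad_orth_flow[OF assms(4) I c] grad_orth_flow[OF assms(4) B c];
          simp add: scaling_field_def binormal_field_def Imm_Csm Csm_frame c)+
    have ker: "ker_form (Omega_Phi \<Phi>) c = kernel_span c"
      using ker_form_iff[where \<Omega> = "Omega_Phi \<Phi>" and A = "omega_op (\<Phi> ?l) (deriv \<Phi> ?l) c", OF c Omega_Phi_eq_G_id[OF c _ _ \<Phi>'[OF c]] Csm_omega_op[OF c]]
        omega_op_kernel[OF c nz(1) deg] by blast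
    show ?thesis
      by (rule projection_onto_kernel_complement[OF c g[OF c] nz(1) deg inv r])
        (use ker in \<open>auto simp: is_hgrad_ker_def ham[OF c]\<close>)
  qed
  from a b binormal_unique show ?thesis
    unfolding kernel_span_def by auto
qed

end
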